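(* Let $X$ be a real Banach space and let $M$ be a (closed) subspace of $X$ which is an ideal in $X$ and which has the isometric lifting property. If $X$ has the Lip-$\mathcal{K}$-BAP and $M^*$ has the B$\mathrm{W}^*$D, then $M$ has the $\mathcal{K}$-BAP.
   Context: All Banach spaces are real. For Banach spaces $X,Y$, $\mathcal{L}(X,Y)$ is the space of bounded linear operators, $\mathcal{K}(X,Y)$ the compact operators, and $\mathrm{Lip}_0(X,Y)$ is the Banach space of Lipschitz maps $f:X\to Y$ with $f(0)=0$, with norm $\|f\|_{\mathrm{Lip}}=\sup_{x\neq y}\|f(x)-f(y)\|/\|x-y\|$; $\mathrm{Lip}_0(X)=\mathrm{Lip}_0(X,\mathbb{R})$. For $x\in X$ let $\delta_x\in \mathrm{Lip}_0(X)^*$, $\delta_x(f)=f(x)$. The Lipschitz-free space is $\mathfrak{F}(X)=\overline{\mathrm{span}}\{\delta_x: x\in X\}\subseteq \mathrm{Lip}_0(X)^*$, and $\delta_X:X\to\mathfrak{F}(X)$, $\delta_X(x)=\delta_x$. For each $f\in\mathrm{Lip}_0(X,Y)$ there is a unique $L_f\in\mathcal{L}(\mathfrak{F}(X),Y)$ with $L_f\delta_X=f$, and $\|L_f\|=\|f\|_{\mathrm{Lip}}$. The map $\beta_X:\mathfrak{F}(X)\to X$ is the bounded linear quotient map determined by $x^*(\beta_X(\mu))=\langle x^*,\mu\rangle$ for all $x^*\in X^*\subseteq\mathrm{Lip}_0(X)$; so $\beta_X(\delta_x)=x$. A Banach space $Z$ has the isometric lifting property if there exists $U\in\mathcal{L}(Z,\mathfrak{F}(Z))$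 with $\|U\|=1$ and $\beta_ZU=\mathrm{Id}_Z$. For $\lambda\ge 1$: $\mathcal{K}^\lambda(X,Y)=\{T\in\mathcal{K}(X,Y):\|T\|\le\lambda\}$; $\mathrm{Lip}_{\mathcal{K}}(X,Y)=\{f\in\mathrm{Lip}_0(X,Y): L_f\in\mathcal{K}(\mathfrak{F}(X),Y)\}$; $\mathrm{Lip}_{\mathcal{K}}^\lambda(X,Y)=\{f\in\mathrm{Lip}_{\mathcal{K}}(X,Y):\|f\|_{\mathrm{Lip}}\le\lambda\}$. $\tau_c$ denotes the compact-open topology (uniform convergence on compact subsets of the domain). A Banach space $Z$ has the $\mathcal{K}$-BAP if $\mathrm{Id}_Z\in\overline{\mathcal{K}^\lambda(Z,Z)}^{\tau_c}$ for some $\lambda\ge1$, and the Lip-$\mathcal{K}$-BAP if $\mathrm{Id}_Z\in\overline{\mathrm{Lip}_{\mathcal{K}}^\lambda(Z,Z)}^{\tau_c}$ for some $\lambda\ge1$. A subspace $M$ of $X$ is an ideal in $X$ (or locally complemented in $X$) if $M^\perp$ is the kernel of a norm-one projection on $X^*$; equivalently, there is a bounded linear $\sigma:M^*\to X^*$ with $\sigma(y^* )(y)=y^*(y)$ and $\|\sigma(y^* )\|=\|y^*\|$ for all $y^*\in M^*$, $y\in M$. The dual space $Z^*$ has the bounded weak-star density for compact operators (B$\mathrm{W}^*$D) if $\mathcal{K}^1(Z^*,Z^* )\subseteq\overline{\mathcal{K}_{w^*}^\lambda(Z^*,Z^* )}^{w^*}$ for some $\lambda\ge1$, where $\mathcal{K}_{w^*}^\lambda(Z^*,Z^*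 )$ is the set of compact operators on $Z^*$ that are weak-star to weak-star continuous and have norm at most $\lambda$, and the closure is in the weak-star topology of $\mathcal{L}(Z^*,Z^* )=(Z^*\widehat{\otimes}_\pi Z)^*$ (projective tensor product, $\langle z^*\otimes z,T\rangle=(Tz^* )(z)$). *)

theory Defs
  imports "HOL-Analysis.Analysis"
begin

section \<open>Lipschitz maps vanishing at the origin\<close>

typedef (overloaded) ('a::real_normed_vector, 'b::real_normed_vector) lip0 =
  "{f :: 'a \<Rightarrow> 'b. f 0 = 0 \<and> (\<exists>C. C-lipschitz_on UNIV f)}"
  morphisms lip0_apply Lip0
  by (intro exI[of _ "\<lambda>_. 0"]) (auto intro: lipschitz_on_constant)

setup_lifting type_definition_lip0

text \<open>
  The supremum below runs over all pairs of points; the diagonal contributes \<open>0 / 0 = 0\<close>, which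
  does not change the supremum over distinct points and gives the value \<open>0\<close> on the zero space.
\<close>

definition lip_const :: "('a::real_normed_vector \<Rightarrow> 'b::real_normed_vector) \<Rightarrow> real" where
  "lip_const f = (SUP p. norm (f (fst p) - f (snd p)) / norm (fst p - snd p))"

lemma lip_quotient_le:
  assumes "C-lipschitz_on UNIV f"
  shows "norm (f x - f y) / norm (x - y) \<le> C"
proof (cases "x = y")
  case True
  then show ?thesis using lipschitz_on_nonneg[OF assms] by simp
next
  case False
  then show ?thesis
    using lipschitz_onD[OF assms, of x y] by (simp add: dist_norm divide_le_eq)
qed

lemma lip_const_le:
  assumes "C-lipschitz_on UNIV f"
  shows "lip_const f \<le> C"
  unfolding lip_const_def by (rule cSUP_least) (auto intro: lip_quotient_le[OF assms])

lemma lip_const_nonneg_and_bound: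
  assumes "\<exists>C. C-lipschitz_on UNIV f"
  shows "0 \<le> lip_const f" "norm (f x - f y) \<le> lip_const f * norm (x - y)"
proof -
  obtain C where C: "C-lipschitz_on UNIV f" using assms by blast
  have bdd: "bdd_above (range (\<lambda>p. norm (f (fst p) - f (snd p)) / norm (fst p - snd p)))"
    by (rule bdd_aboveI2[where M = C]) (rule lip_quotient_le[OF C])
  have le: "norm (f x - f y) / norm (x - y) \<le> lip_const f" for x y
    unfolding lip_const_def using cSUP_upper[OF UNIV_I bdd, of "(x, y)"] by simp
  show "0 \<le> lip_const f" using le[of 0 0] by simp
  show "norm (f x - f y) \<le> lip_const f * norm (x - y)"
    using le[of x y] by (cases "x = y") (auto simp: divide_le_eq)
qed

lemma lip_const_lipschitz_on:
  assumes "\<exists>C. C-lipschitz_on UNIV f"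
  shows "(lip_const f)-lipschitz_on UNIV f"
  using lip_const_nonneg_and_bound[OF assms] by (auto simp: lipschitz_on_def dist_norm)

lemma lip_const_triangle:
  assumes "\<exists>C. C-lipschitz_on UNIV f" "\<exists>C. C-lipschitz_on UNIV g"
  shows "lip_const (\<lambda>x. f x + g x) \<le> lip_const f + lip_const g"
  using assms by (intro lip_const_le lipschitz_on_add lip_const_lipschitz_on)

lemma lip_const_scaleR:
  assumes "\<exists>C. C-lipschitz_on UNIV f"
  shows "lip_const (\<lambda>x. r *\<^sub>R f x) = \<bar>r\<bar> * lip_const f"
proof (rule antisym)
  have le: "lip_const (\<lambda>x. s *\<^sub>R g x) \<le> \<bar>s\<bar> * lip_const g"
    if "\<exists>C. C-lipschitz_on UNIV g" for s and g :: "'a \<Rightarrow> 'b"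
    using that by (intro lip_const_le lipschitz_on_cmult lip_const_lipschitz_on)
  show "lip_const (\<lambda>x. r *\<^sub>R f x) \<le> \<bar>r\<bar> * lip_const f" by (rule le[OF assms])
  show "\<bar>r\<bar> * lip_const f \<le> lip_const (\<lambda>x. r *\<^sub>R f x)"
  proof (cases "r = 0")
    case True
    then show ?thesis by (simp add: lip_const_def)
  next
    case False
    have "\<exists>C. C-lipschitz_on UNIV (\<lambda>x. r *\<^sub>R f x)"
      using assms lipschitz_on_cmult by blast
    from le[OF this, of "inverse r"] False show ?thesis
      by (simp add: field_simps)
  qed
qed

lemma lip_const_eq_0:
  assumes "f 0 = 0" "\<exists>C. C-lipschitz_on UNIV f"
  shows "lip_const f = 0 \<longleftrightarrow> f = (\<lambda>_. 0)"
proof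
  assume "lip_const f = 0"
  then show "f = (\<lambda>_. 0)"
    using lip_const_nonneg_and_bound(2)[OF assms(2), of _ 0] assms(1) by auto
qed (simp add: lip_const_def)

instantiation lip0 :: (real_normed_vector, real_normed_vector) real_normed_vector
begin

lift_definition norm_lip0 :: "('a, 'b) lip0 \<Rightarrow> real" is lip_const .

lift_definition minus_lip0 :: "('a, 'b) lip0 \<Rightarrow> ('a, 'b) lip0 \<Rightarrow> ('a, 'b) lip0"
  is "\<lambda>f g x. f x - g x"
  by (simp, blast intro: lipschitz_on_diff)

lift_definition uminus_lip0 :: "('a, 'b) lip0 \<Rightarrow> ('a, 'b) lip0" is "\<lambda>f x. - f x"
  by simp

lift_definition zero_lip0 :: "('a, 'b) lip0" is "\<lambda>_. 0"
  by (auto intro: lipschitz_on_constant)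

lift_definition plus_lip0 :: "('a, 'b) lip0 \<Rightarrow> ('a, 'b) lip0 \<Rightarrow> ('a, 'b) lip0"
  is "\<lambda>f g x. f x + g x"
  by (simp, blast intro: lipschitz_on_add)

lift_definition scaleR_lip0 :: "real \<Rightarrow> ('a, 'b) lip0 \<Rightarrow> ('a, 'b) lip0"
  is "\<lambda>r f x. r *\<^sub>R f x"
  by (simp, blast intro: lipschitz_on_cmult)

definition dist_lip0 :: "('a, 'b) lip0 \<Rightarrow> ('a, 'b) lip0 \<Rightarrow> real"
  where "dist_lip0 f g = norm (f - g)"

definition [code del]:
  "(uniformity :: (('a, 'b) lip0 \<times> ('a, 'b) lip0) filter) =
    (INF e\<in>{0 <..}. principal {(x, y). dist x y < e})"

definition open_lip0 :: "('a, 'b) lip0 set \<Rightarrow> bool"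
  where [code del]: "open_lip0 S = (\<forall>x\<in>S. \<forall>\<^sub>F (x', y) in uniformity. x' = x \<longrightarrow> y \<in> S)"

definition sgn_lip0 :: "('a, 'b) lip0 \<Rightarrow> ('a, 'b) lip0"
  where "sgn_lip0 f = inverse (norm f) *\<^sub>R f"

instance
proof
  fix f g h :: "('a, 'b) lip0" and r s :: real
  show "dist f g = norm (f - g)" by (rule dist_lip0_def)
  show "sgn f = inverse (norm f) *\<^sub>R f" by (rule sgn_lip0_def)
  show "(uniformity :: (('a, 'b) lip0 \<times> ('a, 'b) lip0) filter) =
    (INF e\<in>{0 <..}. principal {(x, y). dist x y < e})" by (rule uniformity_lip0_def)
  show "open U \<longleftrightarrow> (\<forall>x\<in>U. \<forall>\<^sub>F (x', y) in uniformity. x' = x \<longrightarrow> y \<in> U)"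
    for U :: "('a, 'b) lip0 set" by (rule open_lip0_def)
  show "f + g + h = f + (g + h)" "f + g = g + f" "0 + f = f" "- f + f = 0" "f - g = f + - g"
    "r *\<^sub>R (f + g) = r *\<^sub>R f + r *\<^sub>R g" "(r + s) *\<^sub>R f = r *\<^sub>R f + s *\<^sub>R f"
    "r *\<^sub>R s *\<^sub>R f = (r * s) *\<^sub>R f" "1 *\<^sub>R f = f"
    by (transfer; simp add: algebra_simps)+
  show "norm f = 0 \<longleftrightarrow> f = 0" by transfer (simp add: lip_const_eq_0)
  show "norm (f + g) \<le> norm f + norm g" by transfer (simp add: lip_const_triangle)
  show "norm (r *\<^sub>R f) = \<bar>r\<bar> * norm f" by transfer (simp add: lip_const_scaleR)
qed

end

lemma norm_lip0_bound: "norm (lip0_apply f x - lip0_apply f y) \<le> norm f * norm (x - y)"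
  by transfer (auto intro: lip_const_nonneg_and_bound)

lemma norm_lip0_apply_le: "norm (lip0_apply f x) \<le> norm f * norm x"
proof -
  have "lip0_apply f 0 = 0" by transfer simp
  then show ?thesis using norm_lip0_bound[of f x 0] by simp
qed

lemma blinfun_in_lip0: "blinfun_apply T 0 = 0 \<and> (\<exists>C. C-lipschitz_on UNIV (blinfun_apply T))"
proof -
  have "(norm T)-lipschitz_on UNIV (blinfun_apply T)"
    by (rule lipschitz_onI)
      (simp_all add: dist_norm norm_blinfun flip: blinfun.diff_right)
  then show ?thesis by (auto simp: blinfun.zero_right)
qed

lift_definition lip0_of_blinfun ::
    "('a::real_normed_vector \<Rightarrow>\<^sub>L 'b::real_normed_vector) \<Rightarrow> ('a, 'b) lip0"
  is "blinfun_apply"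
  by (rule blinfun_in_lip0)

section \<open>The Lipschitz-free space\<close>

lift_definition point_eval :: "'a::real_normed_vector \<Rightarrow> ('a, real) lip0 \<Rightarrow>\<^sub>L real"
  is "\<lambda>x f. lip0_apply f x"
proof (rule bounded_linear_intro)
  fix x :: 'a and f g :: "('a, real) lip0" and r :: real
  show "lip0_apply (f + g) x = lip0_apply f x + lip0_apply g x" by transfer simp
  show "lip0_apply (r *\<^sub>R f) x = r *\<^sub>R lip0_apply f x" by transfer simp
  show "norm (lip0_apply f x) \<le> norm f * norm x" by (rule norm_lip0_apply_le)
qed

typedef (overloaded) 'a lipfree =
  "closure (span (range (point_eval :: 'a::real_normed_vector \<Rightarrow> _)))"
  morphisms lipfree_functional Lipfree
  by (rule exI[of _ 0]) (use closure_subset span_zero in blast)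

setup_lifting type_definition_lipfree

lemma subspace_closure_span: "subspace (closure (span A))" for A :: "'a::real_normed_vector set"
proof (rule subspaceI)
  show "0 \<in> closure (span A)" using closure_subset span_zero by blast
  show "x + y \<in> closure (span A)" if "x \<in> closure (span A)" "y \<in> closure (span A)" for x y
  proof -
    obtain u where u: "\<And>n. u n \<in> span A" "u \<longlonglongrightarrow> x" using \<open>x \<in> _\<close> by (auto simp: closure_sequential)
    obtain v where v: "\<And>n. v n \<in> span A" "v \<longlonglongrightarrow> y" using \<open>y \<in> _\<close> by (auto simp: closure_sequential)
    have "(\<lambda>n. u n + v n) \<longlonglongrightarrow> x + y" using u v by (intro tendsto_add)
    moreover have "\<forall>n. u n + v n \<in> span A" using u v by (auto intro: span_add)
    ultimately show ?thesis unfolding closure_sequential by (intro exI conjI)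
  qed
  show "r *\<^sub>R x \<in> closure (span A)" if "x \<in> closure (span A)" for r x
  proof -
    obtain u where u: "\<And>n. u n \<in> span A" "u \<longlonglongrightarrow> x" using \<open>x \<in> _\<close> by (auto simp: closure_sequential)
    have "(\<lambda>n. r *\<^sub>R u n) \<longlonglongrightarrow> r *\<^sub>R x" using u by (intro tendsto_scaleR tendsto_const)
    moreover have "\<forall>n. r *\<^sub>R u n \<in> span A" using u by (auto intro: span_scale)
    ultimately show ?thesis unfolding closure_sequential by (intro exI conjI)
  qed
qed

instantiation lipfree :: (real_normed_vector) real_normed_vector
begin

lift_definition norm_lipfree :: "'a lipfree \<Rightarrow> real" is norm .

lift_definition minus_lipfree :: "'a lipfree \<Rightarrow> 'a lipfree \<Rightarrow> 'a lipfree" is "(-)"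
  by (intro subspace_diff subspace_closure_span)

lift_definition uminus_lipfree :: "'a lipfree \<Rightarrow> 'a lipfree" is uminus
  by (intro subspace_neg subspace_closure_span)

lift_definition zero_lipfree :: "'a lipfree" is 0
  by (intro subspace_0 subspace_closure_span)

lift_definition plus_lipfree :: "'a lipfree \<Rightarrow> 'a lipfree \<Rightarrow> 'a lipfree" is "(+)"
  by (intro subspace_add subspace_closure_span)

lift_definition scaleR_lipfree :: "real \<Rightarrow> 'a lipfree \<Rightarrow> 'a lipfree" is "(*\<^sub>R)"
  by (intro subspace_scale subspace_closure_span)

definition dist_lipfree :: "'a lipfree \<Rightarrow> 'a lipfree \<Rightarrow> real"
  where "dist_lipfree \<mu> \<nu> = norm (\<mu> - \<nu>)"

definition [code del]:
  "(uniformity :: ('a lipfree \<times> 'a lipfree) filter) =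
    (INF e\<in>{0 <..}. principal {(x, y). dist x y < e})"

definition open_lipfree :: "'a lipfree set \<Rightarrow> bool"
  where [code del]: "open_lipfree S = (\<forall>x\<in>S. \<forall>\<^sub>F (x', y) in uniformity. x' = x \<longrightarrow> y \<in> S)"

definition sgn_lipfree :: "'a lipfree \<Rightarrow> 'a lipfree"
  where "sgn_lipfree \<mu> = inverse (norm \<mu>) *\<^sub>R \<mu>"

instance
proof
  fix f g h :: "'a lipfree" and r s :: real
  show "dist f g = norm (f - g)" by (rule dist_lipfree_def)
  show "sgn f = inverse (norm f) *\<^sub>R f" by (rule sgn_lipfree_def)
  show "(uniformity :: ('a lipfree \<times> 'a lipfree) filter) =
    (INF e\<in>{0 <..}. principal {(x, y). dist x y < e})" by (rule uniformity_lipfree_def)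
  show "open U \<longleftrightarrow> (\<forall>x\<in>U. \<forall>\<^sub>F (x', y) in uniformity. x' = x \<longrightarrow> y \<in> U)"
    for U :: "'a lipfree set" by (rule open_lipfree_def)
  show "f + g + h = f + (g + h)" "f + g = g + f" "0 + f = f" "- f + f = 0" "f - g = f + - g"
    "r *\<^sub>R (f + g) = r *\<^sub>R f + r *\<^sub>R g" "(r + s) *\<^sub>R f = r *\<^sub>R f + s *\<^sub>R f"
    "r *\<^sub>R s *\<^sub>R f = (r * s) *\<^sub>R f" "1 *\<^sub>R f = f"
    by (transfer; simp add: algebra_simps)+
  show "norm f = 0 \<longleftrightarrow> f = 0" by transfer simp
  show "norm (f + g) \<le> norm f + norm g" by transfer (rule norm_triangle_ineq)
  show "norm (r *\<^sub>R f) = \<bar>r\<bar> * norm f" by transfer simp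
qed

end

lift_definition lipfree_delta :: "'a::real_normed_vector \<Rightarrow> 'a lipfree" is point_eval
  by (rule subsetD[OF closure_subset], rule span_base, rule rangeI)

text \<open>
  Both definite descriptions below are well defined when \<open>'b\<close> and \<open>'a\<close>, respectively, are Banach
  spaces: the deltas have dense span and bounded functionals separate points, so the operator is
  unique; by Hahn-Banach the assignment on the deltas is bounded on their span and so extends.
\<close>

definition lipfree_linearization ::
    "('a::real_normed_vector, 'b::real_normed_vector) lip0 \<Rightarrow> 'a lipfree \<Rightarrow>\<^sub>L 'b" where
  "lipfree_linearization f =
    (THE L. \<forall>x. blinfun_apply L (lipfree_delta x) = lip0_apply f x)"

definition lipfree_beta :: "'a::real_normed_vector lipfree \<Rightarrow>\<^sub>L 'a" where
  "lipfree_beta =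
    (THE \<beta>. \<forall>\<mu> (\<phi> :: 'a \<Rightarrow>\<^sub>L real).
       blinfun_apply \<phi> (blinfun_apply \<beta> \<mu>) =
       blinfun_apply (lipfree_functional \<mu>) (lip0_of_blinfun \<phi>))"

definition isometric_lifting_property :: "'z::banach itself \<Rightarrow> bool" where
  "isometric_lifting_property _ \<longleftrightarrow>
    (\<exists>U :: 'z \<Rightarrow>\<^sub>L 'z lipfree. norm U = 1 \<and> lipfree_beta o\<^sub>L U = id_blinfun)"

section \<open>Compact operators and approximation properties\<close>

definition compact_operator :: "('a::real_normed_vector \<Rightarrow>\<^sub>L 'b::real_normed_vector) \<Rightarrow> bool" where
  "compact_operator T \<longleftrightarrow> compact (closure (blinfun_apply T ` cball 0 1))"

definition compact_operators ::
    "real \<Rightarrow> ('a::real_normed_vector \<Rightarrow>\<^sub>L 'b::real_normed_vector) set" where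
  "compact_operators c = {T. compact_operator T \<and> norm T \<le> c}"

definition lip_compact_maps ::
    "real \<Rightarrow> ('a::real_normed_vector, 'b::real_normed_vector) lip0 set" where
  "lip_compact_maps c = {f. compact_operator (lipfree_linearization f) \<and> norm f \<le> c}"

text \<open>
  The topology of uniform convergence on compact sets, on the space of all functions; a set is open
  iff it contains a uniform neighbourhood, over some compact set, of each of its members.
\<close>

definition compact_open_topology :: "('a::metric_space \<Rightarrow> 'b::metric_space) topology" where
  "compact_open_topology =
    topology (\<lambda>U. \<forall>f\<in>U. \<exists>K e. compact K \<and> 0 < e \<and> {g. \<forall>x\<in>K. dist (g x) (f x) < e} \<subseteq> U)"

lemma openin_compact_open_topology:
  "openin compact_open_topology U \<longleftrightarrow>
    (\<forall>f\<in>U. \<exists>K e. compact K \<and> 0 < e \<and> {g. \<forall>x\<in>K. dist (g x) (f x) < e} \<subseteq> U)"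
proof -
  define N where "N f K e = {g. \<forall>x\<in>K. dist (g x) (f x) < e}"
    for f :: "'a \<Rightarrow> 'b" and K and e :: real
  define nb where "nb U f \<longleftrightarrow> (\<exists>K e. compact K \<and> 0 < e \<and> N f K e \<subseteq> U)" for U f
  have nb_Int: "nb (S \<inter> T) f" if S: "nb S f" and T: "nb T f" for S T f
  proof -
    obtain K d where K: "compact K" "0 < d" "N f K d \<subseteq> S" using S unfolding nb_def by blast
    obtain L e where L: "compact L" "0 < e" "N f L e \<subseteq> T" using T unfolding nb_def by blast
    have "N f (K \<union> L) (min d e) \<subseteq> N f K d \<inter> N f L e" by (auto simp: N_def)
    then have "N f (K \<union> L) (min d e) \<subseteq> S \<inter> T" using K(3) L(3) by blast
    moreover have "compact (K \<union> L)" "0 < min d e" using K L by auto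
    ultimately show ?thesis unfolding nb_def by blast
  qed
  have nb_mono: "nb T f" if "nb S f" "S \<subseteq> T" for S T f
    using that unfolding nb_def by (meson subset_trans)
  have "istopology (\<lambda>U. \<forall>f\<in>U. nb U f)"
    unfolding istopology_def
  proof (intro conjI allI impI ballI)
    fix S T f
    assume "\<forall>f\<in>S. nb S f" "\<forall>f\<in>T. nb T f" "f \<in> S \<inter> T"
    then show "nb (S \<inter> T) f" by (simp add: nb_Int)
  next
    fix \<U> f
    assume *: "\<forall>S\<in>\<U>. \<forall>f\<in>S. nb S f" and "f \<in> \<Union>\<U>"
    then obtain S where S: "S \<in> \<U>" "f \<in> S" by blast
    with * have "nb S f" by blast
    then show "nb (\<Union>\<U>) f" by (rule nb_mono) (use S in blast)
  qed
  then have "openin (topology (\<lambda>U. \<forall>f\<in>U. nb U f)) U \<longleftrightarrow> (\<forall>f\<in>U. nb U f)"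
    by (simp only: topology_inverse')
  then show ?thesis unfolding compact_open_topology_def nb_def N_def .
qed

lemma in_closure_of_compact_open_topology:
  "g \<in> compact_open_topology closure_of A \<longleftrightarrow>
    (\<forall>K e. compact K \<longrightarrow> 0 < e \<longrightarrow> (\<exists>f\<in>A. \<forall>x\<in>K. dist (f x) (g x) < e))"
proof -
  let ?B = "\<lambda>f K e. {h. \<forall>x\<in>K. dist (h x) (f x) < e}"
  have top: "topspace compact_open_topology = (UNIV :: ('a \<Rightarrow> 'b) set)"
  proof -
    have "openin compact_open_topology (UNIV :: ('a \<Rightarrow> 'b) set)"
      unfolding openin_compact_open_topology
      by (intro ballI exI[of _ "{}"] exI[of _ 1]) auto
    then show ?thesis using openin_subset by blast
  qed
  show ?thesis
  proof (intro iffI allI impI)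
    fix K :: "'a set" and e :: real
    assume g: "g \<in> compact_open_topology closure_of A" and K: "compact K" and e: "0 < e"
    define W where "W = {h. \<exists>d>0. ?B h K d \<subseteq> ?B g K e}"
    have "openin compact_open_topology W"
      unfolding openin_compact_open_topology
    proof
      fix h assume "h \<in> W"
      then obtain d where d: "d > 0" "?B h K d \<subseteq> ?B g K e" by (auto simp: W_def)
      have "?B h K (d / 2) \<subseteq> W"
      proof
        fix h' assume h': "h' \<in> ?B h K (d / 2)"
        have "?B h' K (d / 2) \<subseteq> ?B h K d"
        proof safe
          fix u x assume "\<forall>x\<in>K. dist (u x) (h' x) < d / 2" "x \<in> K"
          then have "dist (u x) (h' x) < d / 2" "dist (h' x) (h x) < d / 2" using h' by auto
          then show "dist (u x) (h x) < d"
            using dist_triangle[of "u x" "h x" "h' x"] by linarith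
        qed
        then show "h' \<in> W" using d unfolding W_def by (intro CollectI exI[of _ "d / 2"]) auto
      qed
      then show "\<exists>K' e'. compact K' \<and> 0 < e' \<and> ?B h K' e' \<subseteq> W"
        using K d by (intro exI[of _ K] exI[of _ "d / 2"]) auto
    qed
    moreover have "g \<in> W" using e by (auto simp: W_def)
    ultimately obtain f where f: "f \<in> A" "f \<in> W" using g by (auto simp: in_closure_of)
    then obtain d where "d > 0" "?B f K d \<subseteq> ?B g K e" by (auto simp: W_def)
    moreover from \<open>d > 0\<close> have "f \<in> ?B f K d" by auto
    ultimately have "f \<in> ?B g K e" by blast
    then show "\<exists>f\<in>A. \<forall>x\<in>K. dist (f x) (g x) < e" using f by blast
  next
    assume *: "\<forall>K e. compact K \<longrightarrow> 0 < e \<longrightarrow> (\<exists>f\<in>A. \<forall>x\<in>K. dist (f x) (g x) < e)"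
    have "\<exists>f\<in>A. f \<in> T" if T: "g \<in> T" "openin compact_open_topology T" for T
    proof -
      obtain K e where "compact K" "0 < e" and sub: "?B g K e \<subseteq> T"
        using T unfolding openin_compact_open_topology by (auto dest: bspec[of T _ g])
      then obtain f where "f \<in> A" "\<forall>x\<in>K. dist (f x) (g x) < e"
        using *[rule_format, of K e] by blast
      with sub show ?thesis by (intro bexI[of _ f]) auto
    qed
    then show "g \<in> compact_open_topology closure_of A"
      by (auto simp: in_closure_of top)
  qed
qed

definition K_BAP :: "'z::banach itself \<Rightarrow> bool" where
  "K_BAP _ \<longleftrightarrow>
    (\<exists>c\<ge>1. (id :: 'z \<Rightarrow> 'z) \<in> compact_open_topology closure_of (blinfun_apply ` compact_operators c))"

definition Lip_K_BAP :: "'z::banach itself \<Rightarrow> bool" where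
  "Lip_K_BAP _ \<longleftrightarrow>
    (\<exists>c\<ge>1. (id :: 'z \<Rightarrow> 'z) \<in> compact_open_topology closure_of (lip0_apply ` lip_compact_maps c))"

section \<open>Ideals\<close>

definition annihilator :: "'a::real_normed_vector set \<Rightarrow> ('a \<Rightarrow>\<^sub>L real) set" where
  "annihilator M = {\<phi>. \<forall>x\<in>M. blinfun_apply \<phi> x = 0}"

definition is_ideal_in_space :: "'a::banach set \<Rightarrow> bool" where
  "is_ideal_in_space M \<longleftrightarrow>
    (\<exists>P :: ('a \<Rightarrow>\<^sub>L real) \<Rightarrow>\<^sub>L ('a \<Rightarrow>\<^sub>L real).
       P o\<^sub>L P = P \<and> norm P = 1 \<and> {\<phi>. blinfun_apply P \<phi> = 0} = annihilator M)"

section \<open>Projective tensor products and bounded weak-star density\<close>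

text \<open>
  Elementary tensors are realised as functionals on the space of bounded bilinear forms (in curried
  form), so that the algebraic tensor product is their span and the pairing of a tensor \<open>u\<close> with a
  bilinear form \<open>B\<close> is just \<open>u B\<close>.  The completion in the projective norm is realised inside the
  dual of that space, into which the projective tensor product embeds isometrically.
\<close>

lift_definition tensor ::
    "'a::real_normed_vector \<Rightarrow> 'b::real_normed_vector \<Rightarrow> ('a \<Rightarrow>\<^sub>L 'b \<Rightarrow>\<^sub>L real) \<Rightarrow>\<^sub>L real"
  is "\<lambda>x y B. blinfun_apply (blinfun_apply B x) y"
  by (intro bounded_linear_intros bounded_linear_ident)

definition algebraic_tensor_product ::
    "(('a::real_normed_vector \<Rightarrow>\<^sub>L 'b::real_normed_vector \<Rightarrow>\<^sub>L real) \<Rightarrow>\<^sub>L real) set" where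
  "algebraic_tensor_product = span {tensor x y | x y. True}"

definition projective_norm ::
    "(('a::real_normed_vector \<Rightarrow>\<^sub>L 'b::real_normed_vector \<Rightarrow>\<^sub>L real) \<Rightarrow>\<^sub>L real) \<Rightarrow> real" where
  "projective_norm u =
    Inf {\<Sum>i<n. norm (x i) * norm (y i) | (n::nat) x y. u = (\<Sum>i<n. tensor (x i) (y i))}"

definition projective_tensor_product ::
    "(('a::real_normed_vector \<Rightarrow>\<^sub>L 'b::real_normed_vector \<Rightarrow>\<^sub>L real) \<Rightarrow>\<^sub>L real) set" where
  "projective_tensor_product =
    {v. \<exists>u :: nat \<Rightarrow> _. range u \<subseteq> algebraic_tensor_product \<and>
        (\<forall>e>0. \<exists>N. \<forall>m\<ge>N. \<forall>n\<ge>N. projective_norm (u m - u n) < e) \<and> u \<longlonglongrightarrow> v}"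

text \<open>
  A bounded operator \<open>T\<close> on the dual of \<open>'z\<close> is literally a bounded bilinear form on
  \<open>('z \<Rightarrow>\<^sub>L real) \<times> 'z\<close>, and \<open>tensor \<phi> z T = T \<phi> z\<close>.
\<close>

definition dual_operator_weak_star_topology ::
    "(('z::real_normed_vector \<Rightarrow>\<^sub>L real) \<Rightarrow>\<^sub>L ('z \<Rightarrow>\<^sub>L real)) topology" where
  "dual_operator_weak_star_topology =
    pullback_topology UNIV (\<lambda>T. \<lambda>u\<in>projective_tensor_product. blinfun_apply u T)
      (product_topology (\<lambda>_. euclideanreal) projective_tensor_product)"

text \<open>For real-valued functionals the strong operator topology is the weak-star topology.\<close>

abbreviation weak_star_topology :: "('z::real_normed_vector \<Rightarrow>\<^sub>L real) topology" where
  "weak_star_topology \<equiv> strong_operator_topology"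

definition weak_star_compact_operators ::
    "real \<Rightarrow> (('z::real_normed_vector \<Rightarrow>\<^sub>L real) \<Rightarrow>\<^sub>L ('z \<Rightarrow>\<^sub>L real)) set" where
  "weak_star_compact_operators c =
    {T \<in> compact_operators c. continuous_map weak_star_topology weak_star_topology (blinfun_apply T)}"

definition dual_has_BWstarD :: "'z::banach itself \<Rightarrow> bool" where
  "dual_has_BWstarD _ \<longleftrightarrow>
    (\<exists>c\<ge>1. (compact_operators 1 :: (('z \<Rightarrow>\<^sub>L real) \<Rightarrow>\<^sub>L ('z \<Rightarrow>\<^sub>L real)) set)
            \<subseteq> dual_operator_weak_star_topology closure_of weak_star_compact_operators c)"

end

theory Submission
  imports Defs
begin

text \<open>
  Write \<open>Z\<close> for the type \<open>'m\<close>, which \<open>J\<close> identifies with \<open>M\<close>, and \<open>X\<close> for \<open>'x\<close>.  The argument turns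
  Lipschitz approximations on \<open>X\<close> into linear approximations on \<open>Z\<close> by passing through the dual of \<open>Z\<close>.

  Linearization.  Let \<open>f\<close> be a Lipschitz map of norm at most \<open>c\<close> that is close to the identity of
  \<open>X\<close> and has a compact linearization \<open>L\<^sub>f\<close>.  The linearizations have norm at most \<open>c\<close> and the deltas
  span a dense subspace, so \<open>L\<^sub>f\<close> is close to \<open>\<beta>\<^sub>X\<close> at any finite set of points of the free space
  (\<open>lipfree_linearization_approximates_beta\<close>).  If \<open>U\<close> is a norm-one right inverse of \<open>\<beta>\<^sub>Z\<close> and \<open>E\<close> is the
  map of free spaces induced by \<open>J\<close>, then \<open>\<beta>\<^sub>X E U = J \<beta>\<^sub>Z U = J\<close>; hence the compact linear operators \<open>S = L\<^sub>f E U\<close> from \<open>Z\<close>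
  to \<open>X\<close> have norm at most \<open>c\<close> and approximate \<open>J\<close> pointwise (\<open>lifting_compact_approximation\<close>).

  Return to \<open>Z\<close>.  There need be no bounded projection of \<open>X\<close> onto \<open>M\<close>, but an ideal has
  a linear norm-preserving extension operator \<open>\<sigma>\<close> from \<open>Z\<^sup>*\<close> to \<open>X\<^sup>*\<close> (\<open>ideal_extension_operator\<close>).  By
  Schauder's theorem \<open>S\<^sup>* \<sigma>\<close> is a compact operator on \<open>Z\<^sup>*\<close>, and \<open>(S\<^sup>* \<sigma> \<phi>) y = \<sigma> \<phi> (S y)\<close> is close to
  \<open>\<sigma> \<phi> (J y) = \<phi> y\<close> (\<open>dual_identity_approximation\<close>).

  Descent from the dual.  The bounded weak-star density replaces these operators by weak-star
  continuous compact operators, at the cost of another constant.  A weak-star continuous operator on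
  \<open>Z\<^sup>*\<close> is the adjoint of an operator \<open>T\<close> on \<open>Z\<close>, which is compact by the converse half of Schauder's
  theorem.  So the identity of \<open>Z\<close> is approximated in the weak operator topology by a bounded convex
  set of compact operators.  A Hahn-Banach separation argument improves weak to strong approximation
  (\<open>convex_weak_operator_approximation_imp_strong\<close>), and on bounded sets of operators pointwise
  approximation is uniform approximation on compact sets.
\<close>

section \<open>Hahn-Banach theorems for real normed spaces\<close>

definition sublinear :: "('a::real_vector \<Rightarrow> real) \<Rightarrow> bool" where
  "sublinear p \<longleftrightarrow>
    (\<forall>x y. p (x + y) \<le> p x + p y) \<and> (\<forall>t\<ge>0. \<forall>x. p (t *\<^sub>R x) \<le> t * p x)"

lemma sublinearI:
  assumes "\<And>x y. p (x + y) \<le> p x + p y" "\<And>t x. 0 \<le> t \<Longrightarrow> p (t *\<^sub>R x) \<le> t * p x"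
  shows "sublinear p"
  using assms by (auto simp: sublinear_def)

lemma sublinear_add: "sublinear p \<Longrightarrow> p (x + y) \<le> p x + p y"
  and sublinear_scale_le: "sublinear p \<Longrightarrow> 0 \<le> t \<Longrightarrow> p (t *\<^sub>R x) \<le> t * p x"
  by (auto simp: sublinear_def)

lemma sublinear_zero: "sublinear p \<Longrightarrow> p 0 = 0"
  using sublinear_add[of p 0 0] sublinear_scale_le[of p 0 0] by simp

lemma sublinear_lower: "sublinear p \<Longrightarrow> - p (- x) \<le> p x"
  using sublinear_add[of p x "- x"] sublinear_zero[of p] by simp

lemma sublinear_scale_ge:
  assumes "sublinear p" "0 \<le> t"
  shows "t * p x \<le> p (t *\<^sub>R x)"
proof (cases "t = 0")
  case True
  then show ?thesis using sublinear_zero[OF assms(1)] by simp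
next
  case False
  then show ?thesis
    using sublinear_scale_le[OF assms(1), of "inverse t" "t *\<^sub>R x"] assms(2) by (simp add: field_simps)
qed

text \<open>
  Minimal sublinear functionals, lower bounds of chains and the functional that encodes a
  separation problem all arise as pointwise infima; the index \<open>k\<close> may depend on the points.
\<close>

lemma sublinear_INF:
  fixes h :: "'i \<Rightarrow> 'a::real_vector \<Rightarrow> real"
  assumes "I \<noteq> {}" and bdd: "\<And>x. bdd_below ((\<lambda>i. h i x) ` I)"
    and add: "\<And>i j x y. i \<in> I \<Longrightarrow> j \<in> I \<Longrightarrow> \<exists>k\<in>I. h k (x + y) \<le> h i x + h j y"
    and scale: "\<And>i t x. i \<in> I \<Longrightarrow> 0 \<le> t \<Longrightarrow> \<exists>k\<in>I. h k (t *\<^sub>R x) \<le> t * h i x"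
  shows "sublinear (\<lambda>x. INF i\<in>I. h i x)"
proof (rule sublinearI)
  have lower: "(INF i\<in>I. h i x) \<le> h k x" if "k \<in> I" for k x
    by (rule cINF_lower[OF bdd that])
  fix x y :: 'a
  have "(INF i\<in>I. h i (x + y)) - h j y \<le> h i x" if "i \<in> I" "j \<in> I" for i j
    using add[OF that, of x y] lower[of _ "x + y"] by fastforce
  then have "(INF i\<in>I. h i (x + y)) - h j y \<le> (INF i\<in>I. h i x)" if "j \<in> I" for j
    using that by (intro cINF_greatest[OF \<open>I \<noteq> {}\<close>])
  then have "(INF i\<in>I. h i (x + y)) - (INF i\<in>I. h i x) \<le> h j y" if "j \<in> I" for j
    using that by (force simp: algebra_simps)
  then have "(INF i\<in>I. h i (x + y)) - (INF i\<in>I. h i x) \<le> (INF i\<in>I. h i y)"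
    by (intro cINF_greatest[OF \<open>I \<noteq> {}\<close>])
  then show "(INF i\<in>I. h i (x + y)) \<le> (INF i\<in>I. h i x) + (INF i\<in>I. h i y)" by simp
next
  have lower: "(INF i\<in>I. h i x) \<le> h k x" if "k \<in> I" for k x
    by (rule cINF_lower[OF bdd that])
  fix t :: real and x :: 'a assume t: "0 \<le> t"
  have le: "(INF i\<in>I. h i (t *\<^sub>R x)) \<le> t * h i x" if "i \<in> I" for i
    using scale[OF that t, of x] lower[of _ "t *\<^sub>R x"] by fastforce
  show "(INF i\<in>I. h i (t *\<^sub>R x)) \<le> t * (INF i\<in>I. h i x)"
  proof (cases "t = 0")
    case True
    then show ?thesis using le \<open>I \<noteq> {}\<close> by auto
  next
    case False
    then have "(INF i\<in>I. h i (t *\<^sub>R x)) / t \<le> (INF i\<in>I. h i x)"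
      using t le by (intro cINF_greatest[OF \<open>I \<noteq> {}\<close>]) (simp add: field_simps)
    then show ?thesis using False t by (simp add: field_simps)
  qed
qed

text \<open>
  For a direction \<open>y\<close>, the functional \<open>x \<mapsto> inf\<^bsub>t\<ge>0\<^esub> (q (x + t y) - t q y)\<close> is sublinear and below \<open>q\<close>, so
  minimality makes it equal to \<open>q\<close>.  At \<open>x = - y\<close> and \<open>t = 1\<close> this gives \<open>q (- y) \<le> - q y\<close>: the functional
  \<open>q\<close> is odd, and an odd sublinear functional is linear.
\<close>

lemma minimal_sublinear_imp_linear:
  assumes q: "sublinear q" and min: "\<And>r. sublinear r \<Longrightarrow> r \<le> q \<Longrightarrow> r = q"
  shows "linear q"
proof -
  have odd: "q (- y) = - q y" for y
  proof -
    define h where "h t x = q (x + t *\<^sub>R y) - t * q y" for t x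
    have lower: "- q (- x) \<le> h t x" if "0 \<le> t" for t x
      using sublinear_add[OF q, of "x + t *\<^sub>R y" "- x"] sublinear_scale_ge[OF q that, of y]
      by (simp add: h_def)
    then have bdd: "bdd_below ((\<lambda>t. h t x) ` {0..})" for x
      by (intro bdd_belowI2[where m = "- q (- x)"]) auto
    have inf: "(INF t\<in>{0..}. h t x) \<le> h t x" if "0 \<le> t" for t x
      using bdd that by (intro cINF_lower) auto
    have "sublinear (\<lambda>x. INF t\<in>{0..}. h t x)"
    proof (rule sublinear_INF)
      fix s t :: real and x x' :: 'a
      assume st: "s \<in> {0..}" "t \<in> {0..}"
      have "h (s + t) (x + x') \<le> h s x + h t x'"
        using sublinear_add[OF q, of "x + s *\<^sub>R y" "x' + t *\<^sub>R y"]
        by (simp add: h_def algebra_simps)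
      then show "\<exists>k\<in>{0..}. h k (x + x') \<le> h s x + h t x'" using st by (intro bexI[of _ "s + t"]) auto
    next
      fix s t :: real and x :: 'a
      assume st: "s \<in> {0..}" "0 \<le> t"
      have "h (t * s) (t *\<^sub>R x) \<le> t * h s x"
        using sublinear_scale_le[OF q st(2), of "x + s *\<^sub>R y"] by (simp add: h_def algebra_simps)
      then show "\<exists>k\<in>{0..}. h k (t *\<^sub>R x) \<le> t * h s x" using st by (intro bexI[of _ "t * s"]) auto
    qed (use bdd in auto)
    moreover have "(\<lambda>x. INF t\<in>{0..}. h t x) \<le> q"
      using inf[of 0] by (auto simp: h_def le_fun_def)
    ultimately have "(\<lambda>x. INF t\<in>{0..}. h t x) = q" by (rule min)
    then have "q (- y) \<le> h 1 (- y)" using inf[of 1 "- y"] by (simp add: fun_eq_iff)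
    then have "q (- y) \<le> - q y" by (simp add: h_def sublinear_zero[OF q])
    with sublinear_lower[OF q, of y] show ?thesis by simp
  qed
  have add: "q (x + y) = q x + q y" for x y
    using sublinear_add[OF q, of x y] sublinear_add[OF q, of "- x" "- y"] odd[of x] odd[of y] odd[of "x + y"]
    by simp
  have pos: "q (t *\<^sub>R x) = t * q x" if "0 \<le> t" for t x
    using sublinear_scale_le[OF q that, of x] sublinear_scale_ge[OF q that, of x] by simp
  have "q (t *\<^sub>R x) = t * q x" for t x
    using pos[of t x] pos[of "- t" x] odd[of "t *\<^sub>R x"] by (cases "0 \<le> t") auto
  with add show ?thesis by (intro linearI) auto
qed

text \<open>
  By Zorn's lemma there is a minimal sublinear functional below \<open>p\<close>.  A chain has a lower bound because
  every sublinear \<open>q \<le> p\<close> satisfies \<open>q x \<ge> - q (- x) \<ge> - p (- x)\<close>.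
\<close>

theorem hahn_banach_sublinear:
  assumes p: "sublinear p"
  obtains \<phi> where "linear \<phi>" "\<And>x. \<phi> x \<le> p x"
proof -
  define A where "A = {q. sublinear q \<and> q \<le> p}"
  have "\<exists>m\<in>A. \<forall>q\<in>A. q \<le> m \<longrightarrow> q = m"
  proof (rule predicate_Zorn)
    show "partial_order_on A (relation_of (\<lambda>q r. r \<le> q) A)"
      by (rule partial_order_on_relation_ofI) auto
  next
    fix C assume C: "C \<in> Chains (relation_of (\<lambda>q r. r \<le> q) A)"
    have CA: "q \<in> A" if "q \<in> C" for q using Chains_relation_of[OF C] that by blast
    have tot: "q \<le> r \<or> r \<le> q" if "q \<in> C" "r \<in> C" for q r
      using C that by (auto simp: Chains_def relation_of_def)
    show "\<exists>u\<in>A. \<forall>q\<in>C. u \<le> q"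
    proof (cases "C = {}")
      case True
      then show ?thesis using p by (auto simp: A_def)
    next
      case False
      have lower: "- p (- x) \<le> q x" if "q \<in> C" for q x
      proof -
        have "sublinear q" "q (- x) \<le> p (- x)" using CA[OF that] by (auto simp: A_def le_fun_def)
        then show ?thesis using sublinear_lower[of q x] by simp
      qed
      then have bdd: "bdd_below ((\<lambda>q. q x) ` C)" for x
        by (intro bdd_belowI2[where m = "- p (- x)"])
      have "sublinear (\<lambda>x. INF q\<in>C. q x)"
      proof (rule sublinear_INF[OF False bdd])
        fix q r x y assume qr: "q \<in> C" "r \<in> C"
        then have sub: "q (x + y) \<le> q x + q y" "r (x + y) \<le> r x + r y"
          using CA sublinear_add by (auto simp: A_def)
        from tot[OF qr] show "\<exists>k\<in>C. k (x + y) \<le> q x + r y"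
        proof
          assume "q \<le> r"
          then have "q y \<le> r y" by (simp add: le_fun_def)
          with sub(1) show ?thesis using qr(1) by (intro bexI[of _ q]) auto
        next
          assume "r \<le> q"
          then have "r x \<le> q x" by (simp add: le_fun_def)
          with sub(2) show ?thesis using qr(2) by (intro bexI[of _ r]) auto
        qed
      next
        fix q t x assume "q \<in> C" "0 \<le> (t::real)"
        then show "\<exists>k\<in>C. k (t *\<^sub>R x) \<le> t * q x"
          using CA sublinear_scale_le by (intro bexI[of _ q]) (auto simp: A_def)
      qed
      moreover have inf: "(\<lambda>x. INF q\<in>C. q x) \<le> q" if "q \<in> C" for q
        unfolding le_fun_def by (intro allI cINF_lower bdd that)
      moreover have "(\<lambda>x. INF q\<in>C. q x) \<le> p"
      proof -
        obtain q where "q \<in> C" using False by blast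
        then have "q \<le> p" using CA by (simp add: A_def)
        with inf[OF \<open>q \<in> C\<close>] show ?thesis by (rule order_trans)
      qed
      ultimately have "(\<lambda>x. INF q\<in>C. q x) \<in> A" by (simp add: A_def)
      with inf show ?thesis by blast
    qed
  qed
  then obtain q where q: "q \<in> A" "\<And>r. r \<in> A \<Longrightarrow> r \<le> q \<Longrightarrow> r = q" by blast
  have "r = q" if "sublinear r" "r \<le> q" for r
  proof (rule q(2))
    have "r \<le> p" using that(2) q(1) unfolding A_def by (blast intro: order_trans)
    with that(1) show "r \<in> A" by (simp add: A_def)
  qed (rule that(2))
  with q(1) have "linear q" by (intro minimal_sublinear_imp_linear) (simp_all add: A_def)
  with q(1) show ?thesis by (intro that[of q]) (auto simp: A_def le_fun_def)
qed

lemma blinfun_of_bounded_map: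
  fixes f :: "'a::real_normed_vector \<Rightarrow> 'b::real_normed_vector"
  assumes "\<And>x y. f (x + y) = f x + f y" "\<And>r x. f (r *\<^sub>R x) = r *\<^sub>R f x"
    and bound: "\<And>x. norm (f x) \<le> C * norm x" and "0 \<le> C"
  obtains F where "norm F \<le> C" "\<And>x. blinfun_apply F x = f x"
proof (rule that[of "Blinfun f"])
  have "bounded_linear f"
    by (rule bounded_linear_intro[where K = C]) (simp_all add: assms mult.commute)
  then show F: "Blinfun f x = f x" for x by (simp add: bounded_linear_Blinfun_apply)
  show "norm (Blinfun f) \<le> C" by (rule norm_blinfun_bound) (simp_all add: F bound \<open>0 \<le> C\<close>)
qed

text \<open>
  A pair \<open>(k, r)\<close> of the cone is a request that the functional be at least \<open>r\<close> at \<open>k\<close>.  All requests can be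
  met at once by a functional of norm at most \<open>C\<close> as soon as each single one can: a linear functional
  below \<open>x \<mapsto> inf (C |x + k| - r)\<close> meets them, as one sees at \<open>x = - k\<close>.  Separation of convex sets
  and extension of functionals are the two instances used below.
\<close>

theorem hahn_banach_cone:
  fixes G :: "('a::real_normed_vector \<times> real) set"
  assumes zero: "(0, 0) \<in> G"
    and add: "\<And>k r l s. (k, r) \<in> G \<Longrightarrow> (l, s) \<in> G \<Longrightarrow> (k + l, r + s) \<in> G"
    and scale: "\<And>k r t. (k, r) \<in> G \<Longrightarrow> 0 \<le> t \<Longrightarrow> (t *\<^sub>R k, t * r) \<in> G"
    and bound: "\<And>k r. (k, r) \<in> G \<Longrightarrow> r \<le> C * norm k" and "0 \<le> C"
  obtains \<phi> :: "'a \<Rightarrow>\<^sub>L real" where "norm \<phi> \<le> C" "\<And>k r. (k, r) \<in> G \<Longrightarrow> r \<le> \<phi> k"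
proof -
  define h where "h g x = C * norm (x + fst g) - snd g" for g :: "'a \<times> real" and x
  have lower: "- C * norm x \<le> h g x" if "g \<in> G" for g x
  proof -
    have "snd g \<le> C * norm (fst g)" using bound[of "fst g" "snd g"] that by simp
    also have "\<dots> \<le> C * (norm (x + fst g) + norm x)"
      using norm_triangle_ineq4[of "x + fst g" x] \<open>0 \<le> C\<close> by (intro mult_left_mono) auto
    finally show ?thesis by (simp add: h_def algebra_simps)
  qed
  then have bdd: "bdd_below ((\<lambda>g. h g x) ` G)" for x
    by (intro bdd_belowI2[where m = "- C * norm x"])
  have "sublinear (\<lambda>x. INF g\<in>G. h g x)"
  proof (rule sublinear_INF)
    fix g g' x y assume g: "g \<in> G" "g' \<in> G"
    have "norm (x + y + fst (g + g')) \<le> norm (x + fst g) + norm (y + fst g')"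
      using norm_triangle_ineq[of "x + fst g" "y + fst g'"] by (simp add: algebra_simps)
    then have "h (g + g') (x + y) \<le> h g x + h g' y"
      using mult_left_mono[OF _ \<open>0 \<le> C\<close>] by (fastforce simp: h_def algebra_simps)
    moreover have "g + g' \<in> G" using add[of "fst g" "snd g" "fst g'" "snd g'"] g by (simp add: plus_prod_def)
    ultimately show "\<exists>k\<in>G. h k (x + y) \<le> h g x + h g' y" by blast
  next
    fix g t x assume g: "g \<in> G" "0 \<le> (t::real)"
    have "norm (t *\<^sub>R x + fst (t *\<^sub>R g)) = t * norm (x + fst g)"
      using g(2) by (simp flip: scaleR_add_right)
    then have "h (t *\<^sub>R g) (t *\<^sub>R x) \<le> t * h g x" by (simp add: h_def algebra_simps)
    moreover have "t *\<^sub>R g \<in> G" using scale[of "fst g" "snd g" t] g by (simp add: scaleR_prod_def)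
    ultimately show "\<exists>k\<in>G. h k (t *\<^sub>R x) \<le> t * h g x" by blast
  qed (use zero bdd in auto)
  then obtain \<phi> where \<phi>: "linear \<phi>" "\<And>x. \<phi> x \<le> (INF g\<in>G. h g x)"
    using hahn_banach_sublinear by blast
  have le: "\<phi> x \<le> h g x" if "g \<in> G" for g x
    using \<phi>(2)[of x] cINF_lower[OF bdd that, of x] by simp
  have upper: "\<phi> x \<le> C * norm x" for x using le[OF zero, of x] by (simp add: h_def)
  have abs: "norm (\<phi> x) \<le> C * norm x" for x
    using upper[of x] upper[of "- x"] linear_neg[OF \<phi>(1), of x] by (simp add: abs_le_iff)
  obtain F where F: "norm F \<le> C" "\<And>x. blinfun_apply F x = \<phi> x"
    using blinfun_of_bounded_map[of \<phi> C] abs \<open>0 \<le> C\<close> \<phi>(1) by (auto simp: linear_add linear_scale)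
  show ?thesis
  proof (rule that[of F])
    show "r \<le> F k" if "(k, r) \<in> G" for k r
      using le[OF that, of "- k"] linear_neg[OF \<phi>(1), of k] by (simp add: h_def F)
  qed (rule F)
qed

text \<open>
  The requests are the nonnegative multiples of the pairs \<open>(c, d)\<close>; they form a cone because \<open>C\<close> is convex.
\<close>

theorem hahn_banach_separation:
  fixes C :: "'a::real_normed_vector set"
  assumes "convex C" and d: "\<And>c. c \<in> C \<Longrightarrow> d \<le> norm c" "0 \<le> d"
  obtains \<phi> :: "'a \<Rightarrow>\<^sub>L real" where "norm \<phi> \<le> 1" "\<And>c. c \<in> C \<Longrightarrow> d \<le> \<phi> c"
proof -
  define G where "G = insert (0, 0) ((\<lambda>(t, c). (t *\<^sub>R c, t * d)) ` ({0<..} \<times> C))"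
  have add: "(k + l, r + s) \<in> G" if kr: "(k, r) \<in> G" and ls: "(l, s) \<in> G" for k r l s
  proof -
    consider "(k, r) = (0, 0)" | "(l, s) = (0, 0)"
      | a b t u where "0 < t" "0 < u" "a \<in> C" "b \<in> C" "k = t *\<^sub>R a" "r = t * d" "l = u *\<^sub>R b" "s = u * d"
      using kr ls unfolding G_def by auto
    then show ?thesis
    proof cases
      case 3
      define c where "c = (t / (t + u)) *\<^sub>R a + (u / (t + u)) *\<^sub>R b"
      have "c \<in> C"
        unfolding c_def using 3 by (intro convexD[OF \<open>convex C\<close>]) (auto simp flip: add_divide_distrib)
      moreover have "(t + u) *\<^sub>R c = k + l"
        unfolding c_def scaleR_add_right scaleR_scaleR using 3 by simp
      moreover have "(t + u) * d = r + s" using 3 by (simp add: algebra_simps)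
      ultimately show ?thesis
        using 3 unfolding G_def by (intro insertI2 image_eqI[of _ _ "(t + u, c)"]) auto
    qed (use kr ls in auto)
  qed
  have scale: "(t *\<^sub>R k, t * r) \<in> G" if kr: "(k, r) \<in> G" and t: "0 \<le> t" for k r t
  proof (cases "t = 0 \<or> (k, r) = (0, 0)")
    case False
    then obtain u c where "0 < u" "c \<in> C" "k = u *\<^sub>R c" "r = u * d" using kr unfolding G_def by auto
    then show ?thesis
      using False t unfolding G_def by (intro insertI2 image_eqI[of _ _ "(t * u, c)"]) auto
  qed (auto simp: G_def)
  have bound: "r \<le> 1 * norm k" if "(k, r) \<in> G" for k r
    using that d by (auto simp: G_def mult_left_mono)
  obtain \<phi> :: "'a \<Rightarrow>\<^sub>L real" where \<phi>: "norm \<phi> \<le> 1" "\<And>k r. (k, r) \<in> G \<Longrightarrow> r \<le> \<phi> k"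
    using hahn_banach_cone[OF _ add scale bound, of thesis] by (simp add: G_def)
  have "d \<le> \<phi> c" if "c \<in> C" for c
    using that by (intro \<phi>(2)) (auto simp: G_def intro!: image_eqI[of _ _ "(1, c)"])
  with \<phi>(1) show ?thesis by (rule that)
qed

corollary norming_functional:
  fixes x :: "'a::real_normed_vector"
  obtains \<phi> :: "'a \<Rightarrow>\<^sub>L real" where "norm \<phi> \<le> 1" "\<phi> x = norm x"
proof -
  obtain \<phi> :: "'a \<Rightarrow>\<^sub>L real" where \<phi>: "norm \<phi> \<le> 1" "norm x \<le> \<phi> x"
    using hahn_banach_separation[of "{x}" "norm x"] by auto
  have "\<phi> x \<le> norm \<phi> * norm x" using norm_blinfun[of \<phi> x] by simp
  also have "\<dots> \<le> 1 * norm x" using \<phi>(1) by (intro mult_right_mono) auto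
  finally show ?thesis using \<phi> by (intro that[of \<phi>]) auto
qed

lemma eq_if_functionals_agree:
  fixes x y :: "'a::real_normed_vector"
  assumes "\<And>\<phi> :: 'a \<Rightarrow>\<^sub>L real. blinfun_apply \<phi> x = blinfun_apply \<phi> y"
  shows "x = y"
proof -
  obtain \<phi> :: "'a \<Rightarrow>\<^sub>L real" where "\<phi> (x - y) = norm (x - y)" by (rule norming_functional)
  with assms[of \<phi>] show ?thesis by (simp add: blinfun.diff_right)
qed

lemma norm_le_if_functionals_le:
  fixes x :: "'a::real_normed_vector"
  assumes "\<And>\<phi> :: 'a \<Rightarrow>\<^sub>L real. norm \<phi> \<le> 1 \<Longrightarrow> blinfun_apply \<phi> x \<le> c"
  shows "norm x \<le> c"
proof -
  obtain \<phi> :: "'a \<Rightarrow>\<^sub>L real" where "norm \<phi> \<le> 1" "\<phi> x = norm x" by (rule norming_functional)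
  with assms[of \<phi>] show ?thesis by simp
qed

text \<open>
  The requests are the values of \<open>\<phi>\<close> on the range of \<open>J\<close>.  This range is a subspace, so the
  inequalities also hold at the negatives and become equalities.
\<close>

corollary hahn_banach_extension:
  fixes J :: "'m::real_normed_vector \<Rightarrow> 'x::real_normed_vector" and \<phi> :: "'m \<Rightarrow>\<^sub>L real"
  assumes "linear J" "\<And>y. norm (J y) = norm y"
  obtains \<psi> :: "'x \<Rightarrow>\<^sub>L real" where "norm \<psi> \<le> norm \<phi>" "\<And>y. \<psi> (J y) = \<phi> y"
proof -
  define G where "G = range (\<lambda>y. (J y, blinfun_apply \<phi> y))"
  have GI: "(k, r) \<in> G" if "k = J y" "r = \<phi> y" for k r y using that by (auto simp: G_def)
  have zero: "(0, 0) \<in> G"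
    by (rule GI[of _ 0]) (simp_all add: linear_0[OF assms(1)] blinfun.zero_right)
  have add: "(k + l, r + s) \<in> G" if kr: "(k, r) \<in> G" and ls: "(l, s) \<in> G" for k r l s
  proof -
    obtain y z where "k = J y" "r = \<phi> y" "l = J z" "s = \<phi> z" using kr ls by (auto simp: G_def)
    then show ?thesis by (intro GI[of _ "y + z"]) (simp_all add: blinfun.add_right linear_add[OF assms(1)])
  qed
  have scale: "(t *\<^sub>R k, t * r) \<in> G" if kr: "(k, r) \<in> G" for k r t
  proof -
    obtain y where "k = J y" "r = \<phi> y" using kr by (auto simp: G_def)
    then show ?thesis
      by (intro GI[of _ "t *\<^sub>R y"]) (simp_all add: blinfun.scaleR_right linear_scale[OF assms(1)])
  qed
  have bound: "r \<le> norm \<phi> * norm k" if kr: "(k, r) \<in> G" for k r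
  proof -
    obtain y where "k = J y" "r = \<phi> y" using kr by (auto simp: G_def)
    then show ?thesis using norm_blinfun[of \<phi> y] by (simp add: assms(2))
  qed
  obtain \<psi> :: "'x \<Rightarrow>\<^sub>L real" where \<psi>: "norm \<psi> \<le> norm \<phi>" "\<And>k r. (k, r) \<in> G \<Longrightarrow> r \<le> \<psi> k"
    using hahn_banach_cone[OF zero add scale bound norm_ge_zero] by blast
  have ge: "\<phi> y \<le> \<psi> (J y)" for y using \<psi>(2) by (auto simp: G_def)
  have "\<psi> (J y) = \<phi> y" for y
    using ge[of y] ge[of "- y"] by (simp add: blinfun.minus_right linear_neg[OF assms(1)])
  with \<psi>(1) show ?thesis by (rule that)
qed

section \<open>Compact operators and Schauder's theorem\<close>

text \<open>
  The centres of the nets lie in \<open>S\<close> itself, so for the image of a unit ball they come from points of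
  the ball.
\<close>

lemma compact_closure_iff_finite_nets:
  fixes S :: "'a::complete_space set"
  shows "compact (closure S) \<longleftrightarrow> (\<forall>e>0. \<exists>k. finite k \<and> k \<subseteq> S \<and> (\<forall>x\<in>S. \<exists>y\<in>k. dist x y < e))"
    (is "?L \<longleftrightarrow> ?R")
proof
  assume ?L
  show ?R
  proof (intro allI impI)
    fix e :: real assume e: "0 < e"
    from \<open>?L\<close> obtain k where k: "finite k" "closure S \<subseteq> (\<Union>x\<in>k. ball x (e/2))"
      unfolding compact_eq_totally_bounded using e by (metis half_gt_zero)
    define f where "f c = (SOME y. y \<in> S \<and> dist c y < e / 2)" for c
    define k' where "k' = f ` {c \<in> k. \<exists>y\<in>S. dist c y < e / 2}"
    have f: "f c \<in> S \<and> dist c (f c) < e / 2" if "y \<in> S" "dist c y < e / 2" for c y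
      unfolding f_def by (rule someI[of "\<lambda>y. y \<in> S \<and> dist c y < e / 2"]) (use that in blast)
    have "\<exists>y\<in>k'. dist x y < e" if x: "x \<in> S" for x
    proof -
      have "x \<in> (\<Union>x\<in>k. ball x (e/2))" using k(2) x closure_subset by blast
      then obtain c where c: "c \<in> k" "dist c x < e / 2" by auto
      with f[OF x c(2)] x have "dist x (f c) < e"
        using dist_triangle[of x "f c" c] by (simp add: dist_commute)
      moreover have "f c \<in> k'" unfolding k'_def using c x by blast
      ultimately show ?thesis by blast
    qed
    moreover have "finite k'" unfolding k'_def using k(1) by simp
    moreover have "k' \<subseteq> S" unfolding k'_def using f by blast
    ultimately show "\<exists>k. finite k \<and> k \<subseteq> S \<and> (\<forall>x\<in>S. \<exists>y\<in>k. dist x y < e)" by blast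
  qed
next
  assume R: ?R
  show ?L
    unfolding compact_eq_totally_bounded
  proof (intro conjI allI impI)
    show "complete (closure S)" by (simp add: complete_eq_closed)
    fix e :: real assume e: "0 < e"
    then obtain k where k: "finite k" "\<forall>x\<in>S. \<exists>y\<in>k. dist x y < e/2"
      using R half_gt_zero by meson
    have "closure S \<subseteq> (\<Union>x\<in>k. ball x e)"
    proof
      fix x assume "x \<in> closure S"
      then obtain z where z: "z \<in> S" "dist z x < e / 2"
        using e closure_approachable[of x S] half_gt_zero by blast
      with k(2) obtain y where y: "y \<in> k" "dist z y < e / 2" by blast
      have "dist y x < e"
        using z(2) y(2) dist_triangle[of y x z] by (simp add: dist_commute)
      then show "x \<in> (\<Union>x\<in>k. ball x e)" using y(1) by auto
    qed
    with k(1) show "\<exists>k. finite k \<and> closure S \<subseteq> (\<Union>x\<in>k. ball x e)" by blast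
  qed
qed

lemma compact_operator_iff_finite_nets:
  fixes T :: "'a::real_normed_vector \<Rightarrow>\<^sub>L 'b::banach"
  shows "compact_operator T \<longleftrightarrow>
    (\<forall>e>0. \<exists>k. finite k \<and> k \<subseteq> cball 0 1 \<and> (\<forall>x\<in>cball 0 1. \<exists>y\<in>k. norm (T x - T y) < e))"
    (is "?L \<longleftrightarrow> ?R")
proof -
  have "(\<exists>k. finite k \<and> k \<subseteq> T ` cball 0 1 \<and> (\<forall>x\<in>T ` cball 0 1. \<exists>y\<in>k. dist x y < e)) \<longleftrightarrow>
    (\<exists>k. finite k \<and> k \<subseteq> cball 0 1 \<and> (\<forall>x\<in>cball 0 1. \<exists>y\<in>k. norm (T x - T y) < e))" for e
    by (simp add: ex_finite_subset_image dist_norm)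
  then show ?thesis
    unfolding compact_operator_def compact_closure_iff_finite_nets by simp
qed

text \<open>
  The combinatorial core of Schauder's theorem: for a bounded function of two variables, total
  boundedness of the rows in the sup norm implies that of the columns.  Columns that agree up to
  \<open>\<epsilon>\<close> on a finite \<open>\<epsilon>\<close>-net of rows agree up to \<open>3 \<epsilon>\<close> everywhere, and after rounding to multiples
  of \<open>\<epsilon>\<close> there are only finitely many patterns on the net.
\<close>

lemma finite_nets_transpose:
  fixes b :: "'a \<Rightarrow> 'd \<Rightarrow> real"
  assumes bdd: "\<And>a d. a \<in> A \<Longrightarrow> d \<in> D \<Longrightarrow> \<bar>b a d\<bar> \<le> B"
    and nets: "\<And>e. 0 < e \<Longrightarrow> \<exists>k. finite k \<and> k \<subseteq> A \<and> (\<forall>a\<in>A. \<exists>a'\<in>k. \<forall>d\<in>D. \<bar>b a d - b a' d\<bar> \<le> e)"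
    and "0 < e"
  shows "\<exists>k. finite k \<and> k \<subseteq> D \<and> (\<forall>d\<in>D. \<exists>d'\<in>k. \<forall>a\<in>A. \<bar>b a d - b a d'\<bar> \<le> e)"
proof -
  define \<epsilon> where "\<epsilon> = e / 3"
  have \<epsilon>: "0 < \<epsilon>" using \<open>0 < e\<close> by (simp add: \<epsilon>_def)
  obtain k where k: "finite k" "k \<subseteq> A" "\<forall>a\<in>A. \<exists>a'\<in>k. \<forall>d\<in>D. \<bar>b a d - b a' d\<bar> \<le> \<epsilon>"
    using nets[OF \<epsilon>] by blast
  define F where "F d = (\<lambda>a\<in>k. \<lfloor>b a d / \<epsilon>\<rfloor>)" for d
  have "F d \<in> k \<rightarrow>\<^sub>E {\<lfloor>- B / \<epsilon>\<rfloor>..\<lfloor>B / \<epsilon>\<rfloor>}" if "d \<in> D" for d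
  proof -
    have "\<lfloor>- B / \<epsilon>\<rfloor> \<le> \<lfloor>b a d / \<epsilon>\<rfloor> \<and> \<lfloor>b a d / \<epsilon>\<rfloor> \<le> \<lfloor>B / \<epsilon>\<rfloor>" if "a \<in> k" for a
    proof -
      have "- B \<le> b a d" "b a d \<le> B" using bdd[of a d] k(2) that \<open>d \<in> D\<close> by auto
      then show ?thesis using \<epsilon> by (intro conjI floor_mono divide_right_mono) auto
    qed
    then show ?thesis by (auto simp: F_def)
  qed
  then have "F ` D \<subseteq> k \<rightarrow>\<^sub>E {\<lfloor>- B / \<epsilon>\<rfloor>..\<lfloor>B / \<epsilon>\<rfloor>}" by blast
  then have fin: "finite (F ` D)" by (rule finite_subset) (intro finite_PiE k(1) finite_atLeastAtMost_int)
  define l where "l = inv_into D F ` (F ` D)"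
  have "\<exists>d'\<in>l. \<forall>a\<in>A. \<bar>b a d - b a d'\<bar> \<le> e" if d: "d \<in> D" for d
  proof -
    define d' where "d' = inv_into D F (F d)"
    have Fd: "F d \<in> F ` D" using d by (rule imageI)
    have d': "d' \<in> l" "d' \<in> D" "F d' = F d"
      unfolding d'_def l_def by (rule imageI[OF Fd], rule inv_into_into[OF Fd], rule f_inv_into_f[OF Fd])
    have "\<bar>b a d - b a d'\<bar> \<le> e" if "a \<in> A" for a
    proof -
      obtain a' where a': "a' \<in> k" "\<forall>d\<in>D. \<bar>b a d - b a' d\<bar> \<le> \<epsilon>"
        using k(3) \<open>a \<in> A\<close> by blast
      have "F d a' = F d' a'" using d'(3) by (simp only:)
      then have "\<lfloor>b a' d / \<epsilon>\<rfloor> = \<lfloor>b a' d' / \<epsilon>\<rfloor>" using a'(1) by (simp add: F_def)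
      then have "\<bar>b a' d / \<epsilon> - b a' d' / \<epsilon>\<bar> \<le> 1" by linarith
      then have "\<bar>(b a' d - b a' d') / \<epsilon>\<bar> \<le> 1" by (simp add: diff_divide_distrib)
      then have "\<bar>b a' d - b a' d'\<bar> \<le> \<epsilon>" using \<epsilon> by (simp add: abs_divide)
      moreover have "\<bar>b a d - b a' d\<bar> \<le> \<epsilon>" "\<bar>b a d' - b a' d'\<bar> \<le> \<epsilon>" using a'(2) d d'(2) by simp_all
      ultimately show ?thesis unfolding \<epsilon>_def by linarith
    qed
    with d'(1) show ?thesis by blast
  qed
  moreover have "finite l" using fin by (simp add: l_def)
  moreover have "l \<subseteq> D" unfolding l_def by (intro image_subsetI inv_into_into)
  ultimately show ?thesis by blast
qed

text \<open>
  A relation, because \<open>S\<close> is built from \<open>T\<close> in one use and \<open>T\<close> from \<open>S\<close> in the other.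
\<close>

definition adjoint_pair :: "('a::real_normed_vector \<Rightarrow>\<^sub>L 'b::real_normed_vector) \<Rightarrow>
    (('b \<Rightarrow>\<^sub>L real) \<Rightarrow>\<^sub>L ('a \<Rightarrow>\<^sub>L real)) \<Rightarrow> bool" where
  "adjoint_pair T S \<longleftrightarrow> (\<forall>\<phi> x. blinfun_apply (S \<phi>) x = \<phi> (T x))"

lemma functional_abs_le: "norm \<phi> \<le> 1 \<Longrightarrow> \<bar>blinfun_apply \<phi> x\<bar> \<le> norm x"
  for \<phi> :: "'a::real_normed_vector \<Rightarrow>\<^sub>L real"
proof -
  assume "norm \<phi> \<le> 1"
  then have "norm \<phi> * norm x \<le> 1 * norm x" by (intro mult_right_mono) auto
  then show ?thesis using norm_blinfun[of \<phi> x] by simp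
qed

lemma blinfun_unit_ball_le:
  assumes "norm (T :: 'a::real_normed_vector \<Rightarrow>\<^sub>L 'b::real_normed_vector) \<le> c" "norm x \<le> 1"
  shows "norm (T x) \<le> c"
proof -
  have "norm T * norm x \<le> c * 1"
    using assms order_trans[OF norm_ge_zero assms(1)] by (intro mult_mono) auto
  then show ?thesis using norm_blinfun[of T x] by simp
qed

lemma blinfun_norm_le_if_unit_ball_le:
  assumes "\<And>x. norm x \<le> 1 \<Longrightarrow> norm (blinfun_apply T x) \<le> c" "0 \<le> c"
  shows "norm (T :: 'a::real_normed_vector \<Rightarrow>\<^sub>L 'b::real_normed_vector) \<le> c"
proof (rule norm_blinfun_bound[OF assms(2)])
  fix x
  show "norm (T x) \<le> c * norm x"
  proof (cases "x = 0")
    case False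
    then show ?thesis using assms(1)[of "inverse (norm x) *\<^sub>R x"]
      by (simp add: blinfun.scaleR_right field_simps)
  qed (simp add: blinfun.zero_right)
qed

lemma adjoint_exists:
  fixes T :: "'a::real_normed_vector \<Rightarrow>\<^sub>L 'b::real_normed_vector"
  obtains S where "adjoint_pair T S" "norm S \<le> norm T"
proof -
  have bound: "norm (\<phi> o\<^sub>L T) \<le> norm T * norm \<phi>" for \<phi> :: "'b \<Rightarrow>\<^sub>L real"
    using norm_blinfun_compose[of \<phi> T] by (simp add: mult.commute)
  obtain S where S: "norm S \<le> norm T" "\<And>\<phi> :: 'b \<Rightarrow>\<^sub>L real. blinfun_apply S \<phi> = \<phi> o\<^sub>L T"
    using blinfun_of_bounded_map[of "\<lambda>\<phi> :: 'b \<Rightarrow>\<^sub>L real. \<phi> o\<^sub>L T", OF _ _ bound]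
    by (auto simp: bounded_bilinear.add_left[OF bounded_bilinear_blinfun_compose]
        bounded_bilinear.scaleR_left[OF bounded_bilinear_blinfun_compose])
  then have "adjoint_pair T S" by (simp add: adjoint_pair_def)
  then show ?thesis using S(1) by (rule that)
qed

text \<open>
  The functions \<open>T x\<close> and \<open>S \<phi>\<close> are the rows and the columns of the function \<open>\<phi> (T x)\<close> on the product
  of the two unit balls, and the norm distance of two of them is the sup distance.  Both directions
  are thus the same statement about transposition.
\<close>

theorem schauder:
  fixes T :: "'a::real_normed_vector \<Rightarrow>\<^sub>L 'b::banach"
  assumes "adjoint_pair T S"
  shows "compact_operator T \<longleftrightarrow> compact_operator S"
proof -
  define b where "b x \<phi> = blinfun_apply \<phi> (blinfun_apply T x)" for x and \<phi> :: "'b \<Rightarrow>\<^sub>L real"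
  have S: "S \<phi> x = b x \<phi>" for \<phi> x using assms by (simp add: adjoint_pair_def b_def)
  have bdd: "\<bar>b x \<phi>\<bar> \<le> norm T" if "x \<in> cball 0 1" "\<phi> \<in> cball 0 1" for x \<phi>
    using functional_abs_le[of \<phi> "T x"] blinfun_unit_ball_le[of T "norm T" x] that by (simp add: b_def)
  have T_iff: "norm (T x - T y) \<le> e \<longleftrightarrow> (\<forall>\<phi>\<in>cball 0 1. \<bar>b x \<phi> - b y \<phi>\<bar> \<le> e)" for x y e
  proof
    assume "norm (T x - T y) \<le> e"
    then show "\<forall>\<phi>\<in>cball 0 1. \<bar>b x \<phi> - b y \<phi>\<bar> \<le> e"
      using functional_abs_le[of _ "T x - T y"] by (force simp: b_def blinfun.diff_right)
  next
    assume "\<forall>\<phi>\<in>cball 0 1. \<bar>b x \<phi> - b y \<phi>\<bar> \<le> e"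
    then show "norm (T x - T y) \<le> e"
      by (intro norm_le_if_functionals_le) (auto simp: b_def blinfun.diff_right abs_le_iff)
  qed
  have S_iff: "norm (S \<phi> - S \<psi>) \<le> e \<longleftrightarrow> (\<forall>x\<in>cball 0 1. \<bar>b x \<phi> - b x \<psi>\<bar> \<le> e)" for \<phi> \<psi> e
  proof
    assume "norm (S \<phi> - S \<psi>) \<le> e"
    then show "\<forall>x\<in>cball 0 1. \<bar>b x \<phi> - b x \<psi>\<bar> \<le> e"
      using blinfun_unit_ball_le[of "S \<phi> - S \<psi>" e] by (auto simp: blinfun.diff_left S)
  next
    assume *: "\<forall>x\<in>cball 0 1. \<bar>b x \<phi> - b x \<psi>\<bar> \<le> e"
    then have "0 \<le> e" by (meson abs_ge_zero order_trans centre_in_cball zero_le_one)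
    with * show "norm (S \<phi> - S \<psi>) \<le> e"
      by (intro blinfun_norm_le_if_unit_ball_le) (auto simp: blinfun.diff_left S)
  qed
  \<comment> \<open>The transposition lemma is about non-strict bounds, the definition of a net about strict ones.\<close>
  have le_nets: "(\<forall>e>0. \<exists>k. finite k \<and> P k \<and> (\<forall>x\<in>A. \<exists>y\<in>k. f x y < e)) \<longleftrightarrow>
      (\<forall>e>0. \<exists>k. finite k \<and> P k \<and> (\<forall>x\<in>A. \<exists>y\<in>k. f x y \<le> e))" (is "?l \<longleftrightarrow> ?r")
    for P :: "'c set \<Rightarrow> bool" and A and f :: "'c \<Rightarrow> 'c \<Rightarrow> real"
  proof
    assume ?r
    show ?l
    proof (intro allI impI)
      fix e :: real assume e: "0 < e"
      then obtain k where k: "finite k" "P k" "\<forall>x\<in>A. \<exists>y\<in>k. f x y \<le> e / 2"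
        using \<open>?r\<close> half_gt_zero by meson
      have "e / 2 < e" using e by simp
      then have "\<forall>x\<in>A. \<exists>y\<in>k. f x y < e" using k(3) by (meson order_le_less_trans)
      with k show "\<exists>k. finite k \<and> P k \<and> (\<forall>x\<in>A. \<exists>y\<in>k. f x y < e)" by blast
    qed
  next
    assume ?l
    then show ?r by (meson less_imp_le)
  qed
  show ?thesis
    unfolding compact_operator_iff_finite_nets le_nets T_iff S_iff
  proof (intro iffI allI impI)
    fix e :: real
    assume nets: "\<forall>e>0. \<exists>k. finite k \<and> k \<subseteq> cball 0 1 \<and>
      (\<forall>x\<in>cball 0 1. \<exists>y\<in>k. \<forall>\<phi>\<in>cball 0 1. \<bar>b x \<phi> - b y \<phi>\<bar> \<le> e)" and "0 < e"
    show "\<exists>k. finite k \<and> k \<subseteq> cball 0 1 \<and>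
      (\<forall>\<phi>\<in>cball 0 1. \<exists>\<psi>\<in>k. \<forall>x\<in>cball 0 1. \<bar>b x \<phi> - b x \<psi>\<bar> \<le> e)"
      by (rule finite_nets_transpose[OF bdd nets[rule_format] \<open>0 < e\<close>])
  next
    fix e :: real
    assume nets: "\<forall>e>0. \<exists>k. finite k \<and> k \<subseteq> cball 0 1 \<and>
      (\<forall>\<phi>\<in>cball 0 1. \<exists>\<psi>\<in>k. \<forall>x\<in>cball 0 1. \<bar>b x \<phi> - b x \<psi>\<bar> \<le> e)" and "0 < e"
    show "\<exists>k. finite k \<and> k \<subseteq> cball 0 1 \<and>
      (\<forall>x\<in>cball 0 1. \<exists>y\<in>k. \<forall>\<phi>\<in>cball 0 1. \<bar>b x \<phi> - b y \<phi>\<bar> \<le> e)"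
      by (rule finite_nets_transpose[where b = "\<lambda>\<phi> x. b x \<phi>", OF bdd nets[rule_format] \<open>0 < e\<close>])
  qed
qed

lemma compact_operatorI:
  assumes "compact K" "\<And>x. norm x \<le> 1 \<Longrightarrow> blinfun_apply T x \<in> K"
  shows "compact_operator T"
proof -
  have "closure (T ` cball 0 1) \<subseteq> K"
    using assms by (intro closure_minimal) (auto intro: compact_imp_closed)
  then have "closure (T ` cball 0 1) = K \<inter> closure (T ` cball 0 1)" by blast
  then show ?thesis
    unfolding compact_operator_def using compact_Int_closed[OF assms(1) closed_closure] by metis
qed

lemma compact_operator_compose_right:
  fixes T :: "'b::real_normed_vector \<Rightarrow>\<^sub>L 'c::real_normed_vector" and V :: "'a::real_normed_vector \<Rightarrow>\<^sub>L 'b"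
  assumes "compact_operator T" "norm V \<le> 1"
  shows "compact_operator (T o\<^sub>L V)"
proof (rule compact_operatorI)
  show "compact (closure (T ` cball 0 1))" using assms(1) by (simp add: compact_operator_def)
  fix x :: 'a assume "norm x \<le> 1"
  then have "T (V x) \<in> T ` cball 0 1" using blinfun_unit_ball_le[OF assms(2)] by auto
  then have "T (V x) \<in> closure (T ` cball 0 1)" by (rule subsetD[OF closure_subset])
  then show "(T o\<^sub>L V) x \<in> closure (T ` cball 0 1)" by simp
qed

lemma compact_operator_scaleR:
  assumes "compact_operator T"
  shows "compact_operator (r *\<^sub>R T)"
proof -
  have "(r *\<^sub>R T) ` cball 0 1 = (*\<^sub>R) r ` (T ` cball 0 1)"
    by (auto simp: image_image blinfun.scaleR_left)
  then show ?thesis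
    using compact_scaling[of "closure (T ` cball 0 1)" r] assms
    by (simp add: compact_operator_def closure_scaleR)
qed

lemma compact_operator_add:
  assumes "compact_operator T" "compact_operator T'"
  shows "compact_operator (T + T')"
proof (rule compact_operatorI)
  show "compact {x + y | x y. x \<in> closure (T ` cball 0 1) \<and> y \<in> closure (T' ` cball 0 1)}"
    using assms by (intro compact_sums) (auto simp: compact_operator_def)
  fix x :: 'a assume "norm x \<le> 1"
  then have "T x \<in> closure (T ` cball 0 1)" "T' x \<in> closure (T' ` cball 0 1)"
    by (auto intro!: subsetD[OF closure_subset])
  then show "(T + T') x \<in> {x + y | x y. x \<in> closure (T ` cball 0 1) \<and> y \<in> closure (T' ` cball 0 1)}"
    by (auto simp: blinfun.add_left)
qed

lemma convex_compact_operators: "convex (compact_operators c)"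
proof (rule convexI)
  fix S T :: "'a \<Rightarrow>\<^sub>L 'b" and u v :: real
  assume S: "S \<in> compact_operators c" and T: "T \<in> compact_operators c" and uv: "0 \<le> u" "0 \<le> v" "u + v = 1"
  have "norm (u *\<^sub>R S + v *\<^sub>R T) \<le> u * norm S + v * norm T"
    using norm_triangle_ineq[of "u *\<^sub>R S" "v *\<^sub>R T"] uv by simp
  also have "\<dots> \<le> u * c + v * c"
    using S T uv by (intro add_mono mult_left_mono) (auto simp: compact_operators_def)
  also have "\<dots> = c" using uv by (simp flip: distrib_right)
  finally show "u *\<^sub>R S + v *\<^sub>R T \<in> compact_operators c"
    using S T by (auto simp: compact_operators_def intro!: compact_operator_add compact_operator_scaleR)
qed

lemma compact_operators_scaleR:
  assumes "T \<in> compact_operators c" "0 \<le> r"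
  shows "r *\<^sub>R T \<in> compact_operators (r * c)"
  using assms by (auto simp: compact_operators_def compact_operator_scaleR mult_left_mono)

section \<open>Weak-star topologies\<close>

text \<open>
  Elementary tensors are the only elements of the projective tensor product at which weak-star
  approximation has to be tested.
\<close>

lemma tensor_in_projective_tensor_product: "tensor x y \<in> projective_tensor_product"
proof -
  have "projective_norm (0 :: ('a \<Rightarrow>\<^sub>L 'b \<Rightarrow>\<^sub>L real) \<Rightarrow>\<^sub>L real) \<le> 0"
    unfolding projective_norm_def
  proof (rule cInf_lower)
    show "0 \<in> {\<Sum>i<n. norm (x i) * norm (y i) |(n::nat) (x :: nat \<Rightarrow> 'a) (y :: nat \<Rightarrow> 'b).
        (0 :: ('a \<Rightarrow>\<^sub>L 'b \<Rightarrow>\<^sub>L real) \<Rightarrow>\<^sub>L real) = (\<Sum>i<n. tensor (x i) (y i))}"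
      by (intro CollectI exI[of _ 0]) auto
    show "bdd_below {\<Sum>i<n. norm (x i) * norm (y i) |(n::nat) (x :: nat \<Rightarrow> 'a) (y :: nat \<Rightarrow> 'b).
        (0 :: ('a \<Rightarrow>\<^sub>L 'b \<Rightarrow>\<^sub>L real) \<Rightarrow>\<^sub>L real) = (\<Sum>i<n. tensor (x i) (y i))}"
      by (rule bdd_belowI[of _ 0]) (auto intro!: sum_nonneg)
  qed
  moreover have "tensor x y \<in> algebraic_tensor_product"
    unfolding algebraic_tensor_product_def by (rule span_base) blast
  ultimately show ?thesis
    unfolding projective_tensor_product_def
    by (intro CollectI exI[of _ "\<lambda>_. tensor x y"]) auto
qed

lemma continuous_map_dual_operator_weak_star:
  assumes "u \<in> projective_tensor_product"
  shows "continuous_map dual_operator_weak_star_topology euclideanreal (\<lambda>T. blinfun_apply u T)"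
proof -
  have "continuous_map dual_operator_weak_star_topology euclideanreal
    ((\<lambda>x. x u) \<circ> (\<lambda>T. \<lambda>u\<in>projective_tensor_product. blinfun_apply u T))"
    unfolding dual_operator_weak_star_topology_def
    by (intro continuous_map_pullback continuous_map_product_projection assms)
  then show ?thesis using assms by (simp add: o_def)
qed

lemma weak_star_closure_approximates:
  fixes A :: "(('z::real_normed_vector \<Rightarrow>\<^sub>L real) \<Rightarrow>\<^sub>L ('z \<Rightarrow>\<^sub>L real)) set"
  assumes T: "T \<in> dual_operator_weak_star_topology closure_of A" and "finite F" "0 < e"
  shows "\<exists>S\<in>A. \<forall>(\<phi>, z)\<in>F. \<bar>blinfun_apply (S \<phi>) z - T \<phi> z\<bar> < e"
proof -
  let ?\<tau> = "dual_operator_weak_star_topology :: (('z \<Rightarrow>\<^sub>L real) \<Rightarrow>\<^sub>L ('z \<Rightarrow>\<^sub>L real)) topology"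
  have top: "topspace ?\<tau> = UNIV"
    by (auto simp: dual_operator_weak_star_topology_def topspace_pullback_topology)
  have "openin ?\<tau> {S. \<forall>(\<phi>, z)\<in>F. \<bar>blinfun_apply (blinfun_apply S \<phi>) z - T \<phi> z\<bar> < e}"
    using \<open>finite F\<close>
  proof induction
    case empty
    show ?case using openin_topspace[of ?\<tau>] by (simp add: top)
  next
    case (insert p F)
    obtain \<phi> z where p: "p = (\<phi>, z)" by (cases p)
    have "openin ?\<tau> {S \<in> topspace ?\<tau>. blinfun_apply (tensor \<phi> z) S \<in> ball (T \<phi> z) e}"
      by (rule openin_continuous_map_preimage[OF
            continuous_map_dual_operator_weak_star[OF tensor_in_projective_tensor_product]]) simp
    then have "openin ?\<tau> {S. \<bar>blinfun_apply (blinfun_apply S \<phi>) z - T \<phi> z\<bar> < e}"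
      by (simp add: top tensor.rep_eq dist_real_def abs_minus_commute)
    with insert.IH have "openin ?\<tau> ({S. \<bar>blinfun_apply (blinfun_apply S \<phi>) z - T \<phi> z\<bar> < e} \<inter> {S. \<forall>(\<phi>, z)\<in>F. \<bar>blinfun_apply (blinfun_apply S \<phi>) z - T \<phi> z\<bar> < e})"
      by (intro openin_Int)
    then show ?case by (simp add: p Collect_conj_eq)
  qed
  moreover have "T \<in> {S. \<forall>(\<phi>, z)\<in>F. \<bar>blinfun_apply (blinfun_apply S \<phi>) z - T \<phi> z\<bar> < e}" using \<open>0 < e\<close> by auto
  ultimately obtain S where "S \<in> A" "S \<in> {S. \<forall>(\<phi>, z)\<in>F. \<bar>blinfun_apply (blinfun_apply S \<phi>) z - T \<phi> z\<bar> < e}"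
    using T unfolding in_closure_of by meson
  then show ?thesis by (intro bexI[of _ S]) simp_all
qed

text \<open>
  A functional whose kernel contains the common kernel of finitely many evaluations is a combination
  of them, hence again an evaluation.  In the induction step, a \<open>\<psi>\<close> that vanishes on \<open>F\<close> but not at \<open>z\<close>
  fixes the coefficient of the evaluation at \<open>z\<close>.
\<close>

lemma linear_combination_of_evaluations:
  fixes l :: "('z::real_normed_vector \<Rightarrow>\<^sub>L real) \<Rightarrow> real"
  assumes "finite F" "linear l"
    and "\<And>\<phi>. \<forall>z\<in>F. blinfun_apply \<phi> z = 0 \<Longrightarrow> l \<phi> = 0"
  shows "\<exists>z. \<forall>\<phi>. l \<phi> = blinfun_apply \<phi> z"
  using assms
proof (induction arbitrary: l)
  case empty
  then show ?case by (intro exI[of _ 0]) (simp add: blinfun.zero_right)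
next
  case (insert z F)
  show ?case
  proof (cases "\<exists>\<psi> :: 'z \<Rightarrow>\<^sub>L real. blinfun_apply \<psi> z \<noteq> 0 \<and> (\<forall>w\<in>F. blinfun_apply \<psi> w = 0)")
    case True
    then obtain \<psi> :: "'z \<Rightarrow>\<^sub>L real" where \<psi>: "blinfun_apply \<psi> z \<noteq> 0" "\<forall>w\<in>F. blinfun_apply \<psi> w = 0" by blast
    define c where "c = l \<psi> / \<psi> z"
    define l' where "l' \<phi> = l \<phi> - c * blinfun_apply \<phi> z" for \<phi>
    have "linear l'"
      unfolding l'_def using insert.prems(1)
      by (intro linearI) (auto simp: linear_add linear_scale blinfun.add_left blinfun.scaleR_left algebra_simps)
    moreover have "l' \<phi> = 0" if \<phi>: "\<forall>w\<in>F. blinfun_apply \<phi> w = 0" for \<phi>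
    proof -
      have "l (\<phi> - (\<phi> z / \<psi> z) *\<^sub>R \<psi>) = 0"
        using \<phi> \<psi> by (intro insert.prems(2)) (auto simp: blinfun.diff_left blinfun.scaleR_left)
      then show ?thesis
        using insert.prems(1) by (simp add: linear_diff linear_scale l'_def c_def)
    qed
    ultimately obtain w where "\<forall>\<phi>. l' \<phi> = blinfun_apply \<phi> w" using insert.IH by blast
    then show ?thesis
      by (intro exI[of _ "w + c *\<^sub>R z"]) (auto simp: l'_def blinfun.add_right blinfun.scaleR_right algebra_simps)
  next
    case False
    then show ?thesis using insert.prems by (intro insert.IH) auto
  qed
qed

text \<open>
  A basic weak-star neighbourhood of \<open>0\<close> constrains only finitely many values, so \<open>l\<close> is bounded by \<open>1\<close>
  on the subspace of functionals that vanish at these points, and therefore zero there.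
\<close>

lemma weak_star_continuous_functional:
  fixes l :: "('z::real_normed_vector \<Rightarrow>\<^sub>L real) \<Rightarrow> real"
  assumes "linear l" and cont: "continuous_map weak_star_topology euclideanreal l"
  shows "\<exists>z. \<forall>\<phi>. l \<phi> = blinfun_apply \<phi> z"
proof -
  have "openin weak_star_topology {\<phi> \<in> topspace weak_star_topology. l \<phi> \<in> ball 0 1}"
    by (rule openin_continuous_map_preimage[OF cont]) simp
  then obtain U where U: "open U" "{\<phi>. \<bar>l \<phi>\<bar> < 1} = blinfun_apply -` U"
    by (auto simp: strong_operator_topology_def topspace_pullback_topology openin_pullback_topology)
  have "blinfun_apply 0 \<in> U" using U(2) linear_0[OF assms(1)] by auto
  moreover have "openin (product_topology (\<lambda>_. euclidean) UNIV) U"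
    using U(1) by (simp add: euclidean_product_topology)
  ultimately obtain V where V: "finite {i. V i \<noteq> (UNIV :: real set)}" "blinfun_apply 0 \<in> Pi\<^sub>E UNIV V"
      "Pi\<^sub>E UNIV V \<subseteq> U"
    unfolding openin_product_topology_alt by auto
  have "l \<phi> = 0" if \<phi>: "\<forall>z\<in>{i. V i \<noteq> UNIV}. blinfun_apply \<phi> z = 0" for \<phi>
  proof (rule ccontr)
    assume "l \<phi> \<noteq> 0"
    \<comment> \<open>Rescaled so that its value under \<open>l\<close> is exactly 1.\<close>
    define \<psi> where "\<psi> = (1 / l \<phi>) *\<^sub>R \<phi>"
    have "\<psi> z \<in> V z" for z
      using V(2) \<phi> by (cases "V z = UNIV") (auto simp: \<psi>_def blinfun.scaleR_left PiE_iff)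
    then have "blinfun_apply \<psi> \<in> U" using V(3) by (auto simp: PiE_iff)
    then have "\<bar>l \<psi>\<bar> < 1" using U(2) by auto
    then show False using \<open>l \<phi> \<noteq> 0\<close> by (simp add: \<psi>_def linear_scale[OF assms(1)])
  qed
  from linear_combination_of_evaluations[OF V(1) assms(1) this] show ?thesis .
qed

text \<open>
  For each \<open>z\<close> the functional \<open>\<phi> \<mapsto> S \<phi> z\<close> is weak-star continuous, hence the evaluation at a point,
  which is the value at \<open>z\<close> of the operator sought.
\<close>

theorem weak_star_continuous_operator_is_adjoint:
  fixes S :: "('y::real_normed_vector \<Rightarrow>\<^sub>L real) \<Rightarrow>\<^sub>L ('z::real_normed_vector \<Rightarrow>\<^sub>L real)"
  assumes "continuous_map weak_star_topology weak_star_topology (blinfun_apply S)"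
  obtains T :: "'z \<Rightarrow>\<^sub>L 'y" where "adjoint_pair T S" "norm T \<le> norm S"
proof -
  have "\<exists>y. \<forall>\<phi>. blinfun_apply (S \<phi>) z = blinfun_apply \<phi> y" for z
  proof (rule weak_star_continuous_functional)
    show "linear (\<lambda>\<phi>. blinfun_apply (S \<phi>) z)"
      by (intro linearI) (auto simp: blinfun.add_left blinfun.add_right blinfun.scaleR_left blinfun.scaleR_right)
    show "continuous_map weak_star_topology euclideanreal (\<lambda>\<phi>. blinfun_apply (S \<phi>) z)"
      using assms unfolding continuous_on_strong_operator_topo_iff_coordinatewise by blast
  qed
  then obtain T where T: "\<And>z \<phi>. blinfun_apply (S \<phi>) z = blinfun_apply \<phi> (T z)" by metis
  have bound: "norm (T z) \<le> norm S * norm z" for z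
  proof (rule norm_le_if_functionals_le)
    fix \<phi> :: "'y \<Rightarrow>\<^sub>L real" assume "norm \<phi> \<le> 1"
    have "\<phi> (T z) \<le> norm (S \<phi>) * norm z" using norm_blinfun[of "S \<phi>" z] by (simp add: T)
    also have "\<dots> \<le> norm S * norm z"
      using blinfun_unit_ball_le[OF order_refl \<open>norm \<phi> \<le> 1\<close>, of S] by (intro mult_right_mono) auto
    finally show "\<phi> (T z) \<le> norm S * norm z" .
  qed
  have add: "T (x + y) = T x + T y" for x y
    by (rule eq_if_functionals_agree) (simp add: blinfun.add_right flip: T)
  have scale: "T (r *\<^sub>R x) = r *\<^sub>R T x" for r x
    by (rule eq_if_functionals_agree) (simp add: blinfun.scaleR_right flip: T)
  obtain F where F: "norm F \<le> norm S" "\<And>z. blinfun_apply F z = T z"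
    using blinfun_of_bounded_map[OF add scale bound] by auto
  then have "adjoint_pair F S" by (simp add: adjoint_pair_def T)
  then show ?thesis using F(1) by (rule that)
qed

section \<open>From weak to strong operator approximation\<close>

text \<open>
  Bounded functions on the naturals serve as a normed space that contains the \<open>n\<close>-fold powers of \<open>'b\<close>
  for all \<open>n\<close> at once; every function on the naturals is continuous.
\<close>

definition bcontfun_prefix :: "nat \<Rightarrow> (nat \<Rightarrow> 'b::real_normed_vector) \<Rightarrow> nat \<Rightarrow>\<^sub>C 'b"
  where "bcontfun_prefix n f = Bcontfun (\<lambda>i. if i < n then f i else 0)"

definition bcontfun_single :: "nat \<Rightarrow> 'b::real_normed_vector \<Rightarrow> nat \<Rightarrow>\<^sub>C 'b"
  where "bcontfun_single n y = Bcontfun (\<lambda>i. if i = n then y else 0)"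

lemma apply_bcontfun_prefix: "apply_bcontfun (bcontfun_prefix n f) i = (if i < n then f i else 0)"
proof -
  have "(\<lambda>i. if i < n then f i else 0) \<in> bcontfun"
    by (rule bcontfun_normI[of _ "\<Sum>i<n. norm (f i)"]) (auto intro: member_le_sum sum_nonneg)
  then show ?thesis by (simp add: bcontfun_prefix_def Bcontfun_inverse)
qed

lemma apply_bcontfun_single: "apply_bcontfun (bcontfun_single n y) i = (if i = n then y else 0)"
proof -
  have "(\<lambda>i. if i = n then y else 0) \<in> bcontfun"
    by (rule bcontfun_normI[of _ "norm y"]) auto
  then show ?thesis by (simp add: bcontfun_single_def Bcontfun_inverse)
qed

lemma bounded_linear_bcontfun_single: "bounded_linear (bcontfun_single n)"
proof (rule bounded_linear_intro)
  show "norm (bcontfun_single n y) \<le> norm y * 1" for y :: 'a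
    by (rule norm_bound) (simp add: apply_bcontfun_single)
qed (auto intro!: bcontfun_eqI simp: apply_bcontfun_single)

lemma bcontfun_prefix_eq_sum: "bcontfun_prefix n f = (\<Sum>i<n. bcontfun_single i (f i))"
proof (induction n)
  case 0
  show ?case by (auto intro!: bcontfun_eqI simp: apply_bcontfun_prefix)
next
  case (Suc n)
  have "bcontfun_prefix (Suc n) f = bcontfun_prefix n f + bcontfun_single n (f n)"
    by (auto intro!: bcontfun_eqI simp: apply_bcontfun_prefix apply_bcontfun_single)
  with Suc show ?case by simp
qed

text \<open>
  If no \<open>T\<close> in \<open>C\<close> were within \<open>e\<close> of \<open>A\<close> on \<open>F = {x\<^sub>0, \<dots>, x\<^sub>n\<^sub>-\<^sub>1}\<close>, then the tuples of the vectors
  \<open>T x\<^sub>i - A x\<^sub>i\<close> would form a convex set at distance at least \<open>e\<close> from \<open>0\<close> in the \<open>n\<close>-fold power.  A functional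
  that separates it from \<open>0\<close> is a sum of functionals of the coordinates, which contradicts weak
  approximation at the \<open>n\<close> pairs formed by these functionals and the points \<open>x\<^sub>i\<close>.
\<close>

theorem convex_weak_operator_approximation_imp_strong:
  fixes C :: "('a::real_normed_vector \<Rightarrow>\<^sub>L 'b::real_normed_vector) set"
  assumes "convex C"
    and weak: "\<And>F e. finite F \<Longrightarrow> 0 < e \<Longrightarrow>
      \<exists>T\<in>C. \<forall>(\<phi> :: 'b \<Rightarrow>\<^sub>L real, z)\<in>F. \<bar>blinfun_apply \<phi> (blinfun_apply T z) - \<phi> (A z)\<bar> < e"
    and "finite F" "0 < e"
  shows "\<exists>T\<in>C. \<forall>z\<in>F. norm (blinfun_apply T z - A z) < e"
proof (rule ccontr)
  assume far: "\<not> ?thesis"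
  obtain n and x :: "nat \<Rightarrow> 'a" where F: "F = x ` {i. i < n}"
    using \<open>finite F\<close> by (auto simp: finite_conv_nat_seg_image)
  define v where "v T = bcontfun_prefix n (\<lambda>i. blinfun_apply T (x i) - A (x i))" for T
  have "convex (v ` C)"
  proof (rule convexI)
    fix p q and s t :: real
    assume pq: "p \<in> v ` C" "q \<in> v ` C" and st: "0 \<le> s" "0 \<le> t" "s + t = 1"
    then obtain S T where ST: "p = v S" "q = v T" "S \<in> C" "T \<in> C" by blast
    have "s *\<^sub>R a + t *\<^sub>R a = a" for a :: 'b using st by (simp flip: scaleR_add_left)
    then have "s *\<^sub>R v S + t *\<^sub>R v T = v (s *\<^sub>R S + t *\<^sub>R T)"
      by (intro bcontfun_eqI)
        (auto simp: v_def apply_bcontfun_prefix blinfun.add_left blinfun.scaleR_left algebra_simps)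
    moreover have "s *\<^sub>R S + t *\<^sub>R T \<in> C" using convexD[OF \<open>convex C\<close> ST(3,4) st] .
    ultimately show "s *\<^sub>R p + t *\<^sub>R q \<in> v ` C" by (simp add: ST)
  qed
  moreover have "e \<le> norm c" if "c \<in> v ` C" for c
  proof -
    obtain T where T: "T \<in> C" "c = v T" using \<open>c \<in> v ` C\<close> by blast
    then obtain i where i: "i < n" "e \<le> norm (T (x i) - A (x i))"
      using far by (auto simp: F not_less)
    have "e \<le> norm (apply_bcontfun c i)" using i by (simp add: T v_def apply_bcontfun_prefix)
    also have "\<dots> \<le> norm c" by (rule norm_bounded)
    finally show ?thesis .
  qed
  ultimately obtain \<Phi> :: "(nat \<Rightarrow>\<^sub>C 'b) \<Rightarrow>\<^sub>L real" where \<Phi>: "\<And>c. c \<in> v ` C \<Longrightarrow> e \<le> \<Phi> c"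
    using hahn_banach_separation[of "v ` C" e] \<open>0 < e\<close> by (metis less_imp_le)
  define \<phi> where "\<phi> i = \<Phi> o\<^sub>L Blinfun (bcontfun_single i)" for i
  have \<phi>: "\<phi> i y = \<Phi> (bcontfun_single i y)" for i y
    by (simp add: \<phi>_def bounded_linear_Blinfun_apply[OF bounded_linear_bcontfun_single])
  define d where "d = e / (n + 1)"
  have "0 < d" using \<open>0 < e\<close> by (simp add: d_def)
  have "finite ((\<lambda>i. (\<phi> i, x i)) ` {..<n})" by simp
  from weak[OF this \<open>0 < d\<close>] obtain T where T: "T \<in> C" "\<And>i. i < n \<Longrightarrow> \<bar>\<phi> i (T (x i)) - \<phi> i (A (x i))\<bar> < d"
    by auto
  have "e \<le> \<Phi> (v T)" using \<Phi> T(1) by blast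
  also have "\<Phi> (v T) = (\<Sum>i<n. \<phi> i (T (x i) - A (x i)))"
    by (simp add: v_def bcontfun_prefix_eq_sum blinfun.sum_right \<phi>)
  also have "\<dots> \<le> (\<Sum>i<n. d)"
    using T(2) by (intro sum_mono) (force simp: blinfun.diff_right)
  also have "\<dots> < e" using \<open>0 < e\<close> by (simp add: d_def field_simps)
  finally show False by simp
qed

text \<open>
  Operators of norm at most \<open>c\<close> are equicontinuous, so approximation on a finite net of a compact set
  gives approximation on the whole set.
\<close>

lemma K_BAP_if_pointwise_approximation:
  assumes "1 \<le> c"
    and approx: "\<And>F e. finite F \<Longrightarrow> 0 < e \<Longrightarrow>
      \<exists>T\<in>compact_operators c. \<forall>z\<in>F. norm (blinfun_apply T z - (z :: 'z)) < e"
  shows "K_BAP TYPE('z::banach)"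
  unfolding K_BAP_def
proof (intro exI[of _ c] conjI \<open>1 \<le> c\<close>)
  show "(id :: 'z \<Rightarrow> 'z) \<in> compact_open_topology closure_of (blinfun_apply ` compact_operators c)"
    unfolding in_closure_of_compact_open_topology
  proof (intro allI impI)
    fix K :: "'z set" and e :: real assume K: "compact K" and e: "0 < e"
    define d where "d = e / (2 * (c + 1))"
    have d: "0 < d" "(c + 1) * d = e / 2" using e \<open>1 \<le> c\<close> by (auto simp: d_def field_simps)
    obtain F where F: "finite F" "K \<subseteq> (\<Union>z\<in>F. ball z d)"
      using K d(1) unfolding compact_eq_totally_bounded by blast
    obtain T where T: "T \<in> compact_operators c" "\<forall>z\<in>F. norm (blinfun_apply T z - z) < e / 2"
      using approx[OF F(1), of "e / 2"] e by auto
    have "dist (T x) (id x) < e" if "x \<in> K" for x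
    proof -
      obtain z where z: "z \<in> F" "norm (x - z) < d"
        using F(2) \<open>x \<in> K\<close> by (force simp: dist_norm norm_minus_commute)
      have "norm (T (x - z)) \<le> norm T * norm (x - z)" by (rule norm_blinfun)
      also have "\<dots> \<le> c * d"
        using T(1) z(2) \<open>1 \<le> c\<close> by (intro mult_mono) (auto simp: compact_operators_def)
      finally have Txz: "norm (T (x - z)) \<le> c * d" .
      have "T x - x = T (x - z) + (T z - z) + (z - x)" by (simp add: blinfun.diff_right)
      then have "norm (T x - x) \<le> norm (T (x - z)) + norm (T z - z) + norm (z - x)"
        by (metis norm_triangle_ineq norm_triangle_mono order_refl)
      moreover have "norm (T z - z) < e / 2" using T(2) z(1) by blast
      moreover have "norm (z - x) < d" using z(2) by (simp add: norm_minus_commute)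
      moreover have "c * d + d = e / 2" using d(2) by (simp add: algebra_simps)
      ultimately show ?thesis using Txz by (simp add: dist_norm)
    qed
    with T(1) show "\<exists>f\<in>blinfun_apply ` compact_operators c. \<forall>x\<in>K. dist (f x) (id x) < e" by blast
  qed
qed

section \<open>Lipschitz-free spaces\<close>

lemma lip0_eqI: "(\<And>x. lip0_apply f x = lip0_apply g x) \<Longrightarrow> f = g"
  by (simp add: fun_eq_iff flip: lip0_apply_inject)

lemma lip0_apply_linear:
  "lip0_apply (f + g) x = lip0_apply f x + lip0_apply g x"
  "lip0_apply (r *\<^sub>R f) x = r *\<^sub>R lip0_apply f x"
  by (transfer, simp)+

lemma norm_lip0_le:
  assumes "\<And>x y. norm (lip0_apply f x - lip0_apply f y) \<le> C * norm (x - y)" "0 \<le> C"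
  shows "norm f \<le> C"
proof -
  have "C-lipschitz_on UNIV (lip0_apply f)"
    using assms by (intro lipschitz_onI) (auto simp: dist_norm)
  then show ?thesis by transfer (rule lip_const_le)
qed

lemma norm_lip0_of_blinfun_le: "norm (lip0_of_blinfun T) \<le> norm T"
  by (rule norm_lip0_le) (simp_all add: lip0_of_blinfun.rep_eq norm_blinfun flip: blinfun.diff_right)

lift_definition lip0_comp ::
    "('b::real_normed_vector, 'c::real_normed_vector) lip0 \<Rightarrow> ('a::real_normed_vector, 'b) lip0 \<Rightarrow> ('a, 'c) lip0"
  is "\<lambda>g f x. g (f x)"
  by (auto, blast intro: lipschitz_on_compose2[of _ UNIV] lipschitz_on_subset)

lemma norm_lip0_comp_le: "norm (lip0_comp g f) \<le> norm g * norm f"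
proof (rule norm_lip0_le)
  fix x y
  have "norm (lip0_apply (lip0_comp g f) x - lip0_apply (lip0_comp g f) y)
      \<le> norm g * norm (lip0_apply f x - lip0_apply f y)"
    unfolding lip0_comp.rep_eq by (rule norm_lip0_bound)
  also have "\<dots> \<le> norm g * (norm f * norm (x - y))"
    by (intro mult_left_mono norm_lip0_bound norm_ge_zero)
  finally show "norm (lip0_apply (lip0_comp g f) x - lip0_apply (lip0_comp g f) y)
      \<le> norm g * norm f * norm (x - y)" by (simp add: mult.assoc)
qed simp

lemma bounded_linear_lipfree_functional: "bounded_linear lipfree_functional"
  by (rule bounded_linear_intro[where K = 1])
    (simp_all add: plus_lipfree.rep_eq scaleR_lipfree.rep_eq norm_lipfree.rep_eq)

lemmas lipfree_functional_linear =
  plus_lipfree.rep_eq minus_lipfree.rep_eq scaleR_lipfree.rep_eq zero_lipfree.rep_eq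

lemma closure_span_lipfree_delta: "closure (span (range lipfree_delta)) = UNIV"
proof -
  have "\<exists>\<nu>\<in>span (range lipfree_delta). dist \<nu> \<mu> < e" if "0 < e" for \<mu> :: "'a lipfree" and e
  proof -
    have "lipfree_functional \<mu> \<in> closure (span (range point_eval))" by (rule lipfree_functional)
    then obtain m where m: "m \<in> span (range point_eval)" "norm (m - lipfree_functional \<mu>) < e"
      using \<open>0 < e\<close> unfolding closure_approachable dist_norm by blast
    have "range point_eval = lipfree_functional ` range (lipfree_delta :: 'a \<Rightarrow> _)"
      by (auto simp: image_image lipfree_delta.rep_eq)
    then have "m \<in> lipfree_functional ` span (range lipfree_delta)"
      using m(1) linear_span_image[OF bounded_linear.linear[OF bounded_linear_lipfree_functional]] by metis
    then obtain \<nu> where \<nu>: "\<nu> \<in> span (range lipfree_delta)" "m = lipfree_functional \<nu>" by blast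
    then have "dist \<nu> \<mu> < e" using m(2) by (simp add: dist_norm norm_lipfree.rep_eq minus_lipfree.rep_eq)
    with \<nu>(1) show ?thesis by blast
  qed
  then show ?thesis by (auto simp: closure_approachable)
qed

lemma lipfree_closed_subspace_induct:
  assumes "subspace S" "closed S" "\<And>x. lipfree_delta x \<in> S"
  shows "\<mu> \<in> S"
proof -
  have "span (range lipfree_delta) \<subseteq> S" using assms(1,3) by (intro span_minimal) auto
  then have "closure (span (range lipfree_delta)) \<subseteq> S" using assms(2) by (intro closure_minimal)
  then show ?thesis by (auto simp: closure_span_lipfree_delta)
qed

lemma lipfree_blinfun_eqI:
  fixes L L' :: "'a::real_normed_vector lipfree \<Rightarrow>\<^sub>L 'b::real_normed_vector"
  assumes "\<And>x. L (lipfree_delta x) = L' (lipfree_delta x)"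
  shows "L = L'"
proof (rule blinfun_eqI)
  fix \<mu> :: "'a lipfree"
  have "\<mu> \<in> {\<mu>. L \<mu> = L' \<mu>}"
  proof (rule lipfree_closed_subspace_induct)
    show "subspace {\<mu>. L \<mu> = L' \<mu>}"
      by (rule subspaceI) (auto simp: blinfun.zero_right blinfun.add_right blinfun.scaleR_right)
    show "closed {\<mu>. L \<mu> = L' \<mu>}" by (intro closed_Collect_eq continuous_intros)
  qed (simp add: assms)
  then show "L \<mu> = L' \<mu>" by simp
qed

text \<open>
  The value at \<open>\<mu>\<close> is the vector \<open>y\<close> with \<open>\<phi> y = \<mu> (\<phi> \<circ> f)\<close> for all functionals \<open>\<phi>\<close>.  The norm of such
  a \<open>y\<close> is at most \<open>norm f * norm \<mu>\<close>, so by completeness of the target the set of those \<open>\<mu>\<close> that have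
  one is a closed subspace; it contains the deltas, hence everything.
\<close>

lemma lipfree_linearization_exists:
  fixes f :: "('a::real_normed_vector, 'b::banach) lip0"
  obtains L :: "'a lipfree \<Rightarrow>\<^sub>L 'b" where "norm L \<le> norm f"
    "\<And>\<mu> \<phi>. blinfun_apply \<phi> (blinfun_apply L \<mu>) = lipfree_functional \<mu> (lip0_comp (lip0_of_blinfun \<phi>) f)"
proof -
  define R where "R \<mu> y \<longleftrightarrow>
    (\<forall>\<phi>. blinfun_apply \<phi> y = lipfree_functional \<mu> (lip0_comp (lip0_of_blinfun \<phi>) f))" for \<mu> y
  have R_add: "R (\<mu> + \<nu>) (y + z)" if "R \<mu> y" "R \<nu> z" for \<mu> \<nu> y z
    using that by (simp add: R_def lipfree_functional_linear blinfun.add_left blinfun.add_right)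
  have R_scale: "R (r *\<^sub>R \<mu>) (r *\<^sub>R y)" if "R \<mu> y" for r \<mu> y
    using that by (simp add: R_def lipfree_functional_linear blinfun.scaleR_left blinfun.scaleR_right)
  have R_bound: "norm y \<le> norm f * norm \<mu>" if "R \<mu> y" for \<mu> y
  proof (rule norm_le_if_functionals_le)
    fix \<phi> :: "'b \<Rightarrow>\<^sub>L real" assume \<phi>: "norm \<phi> \<le> 1"
    have "norm (lip0_comp (lip0_of_blinfun \<phi>) f) \<le> norm (lip0_of_blinfun \<phi>) * norm f"
      by (rule norm_lip0_comp_le)
    also have "\<dots> \<le> 1 * norm f"
      using norm_lip0_of_blinfun_le[of \<phi>] \<phi> by (intro mult_right_mono) auto
    finally have n: "norm (lip0_comp (lip0_of_blinfun \<phi>) f) \<le> norm f" by simp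
    have "\<phi> y \<le> norm (lipfree_functional \<mu> (lip0_comp (lip0_of_blinfun \<phi>) f))"
      using that by (simp add: R_def)
    also have "\<dots> \<le> norm \<mu> * norm (lip0_comp (lip0_of_blinfun \<phi>) f)"
      unfolding norm_lipfree.rep_eq by (rule norm_blinfun)
    also have "\<dots> \<le> norm f * norm \<mu>" using mult_left_mono[OF n norm_ge_zero[of \<mu>]] by (simp add: mult.commute)
    finally show "\<phi> y \<le> norm f * norm \<mu>" .
  qed
  have R_diff: "R (\<mu> - \<nu>) (y - z)" if "R \<mu> y" "R \<nu> z" for \<mu> \<nu> y z
    using R_add[OF that(1) R_scale[OF that(2), of "- 1"]] by simp
  have ex: "\<mu> \<in> {\<mu>. \<exists>y. R \<mu> y}" for \<mu>
  proof (rule lipfree_closed_subspace_induct)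
    show "subspace {\<mu>. \<exists>y. R \<mu> y}"
    proof (rule subspaceI)
      show "0 \<in> {\<mu>. \<exists>y. R \<mu> y}"
        by (auto simp: R_def lipfree_functional_linear blinfun.zero_right intro!: exI[of _ 0])
    qed (use R_add R_scale in blast)+
    show "lipfree_delta x \<in> {\<mu>. \<exists>y. R \<mu> y}" for x
      by (auto simp: R_def lipfree_delta.rep_eq point_eval.rep_eq lip0_comp.rep_eq lip0_of_blinfun.rep_eq)
    show "closed {\<mu>. \<exists>y. R \<mu> y}"
      unfolding closed_sequential_limits
    proof (intro allI impI)
      fix m \<mu> assume "(\<forall>n. m n \<in> {\<mu>. \<exists>y. R \<mu> y}) \<and> m \<longlonglongrightarrow> \<mu>"
      then have "\<forall>n. \<exists>y. R (m n) y" and m: "m \<longlonglongrightarrow> \<mu>" by auto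
      then obtain y where y: "\<And>n. R (m n) (y n)" by metis
      have "Cauchy y"
        unfolding Cauchy_altdef2
      proof (intro allI impI)
        fix e :: real assume "0 < e"
        then have "0 < e / (norm f + 1)" by (simp add: add_nonneg_pos)
        with LIMSEQ_imp_Cauchy[OF m] obtain N where N: "\<forall>n\<ge>N. dist (m n) (m N) < e / (norm f + 1)"
          unfolding Cauchy_altdef2 by blast
        have "dist (y n) (y N) < e" if "n \<ge> N" for n
        proof -
          have "dist (y n) (y N) \<le> norm f * norm (m n - m N)"
            unfolding dist_norm by (rule R_bound[OF R_diff[OF y y]])
          also have "\<dots> \<le> (norm f + 1) * norm (m n - m N)" by (intro mult_right_mono) auto
          also have "\<dots> < e"
            using N that by (simp add: dist_norm pos_less_divide_eq add_nonneg_pos mult.commute)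
          finally show ?thesis .
        qed
        then show "\<exists>N. \<forall>n\<ge>N. dist (y n) (y N) < e" by blast
      qed
      then obtain z where z: "y \<longlonglongrightarrow> z" using Cauchy_convergent convergent_def by blast
      have "R \<mu> z"
        unfolding R_def
      proof
        fix \<phi> :: "'b \<Rightarrow>\<^sub>L real"
        have "(\<lambda>n. \<phi> (y n)) \<longlonglongrightarrow> \<phi> z" by (intro tendsto_intros z)
        moreover have "(\<lambda>n. lipfree_functional (m n) (lip0_comp (lip0_of_blinfun \<phi>) f))
            \<longlonglongrightarrow> lipfree_functional \<mu> (lip0_comp (lip0_of_blinfun \<phi>) f)"
          by (intro tendsto_intros bounded_linear.tendsto[OF bounded_linear_lipfree_functional] m)
        ultimately show "\<phi> z = lipfree_functional \<mu> (lip0_comp (lip0_of_blinfun \<phi>) f)"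
          using y LIMSEQ_unique unfolding R_def by simp
      qed
      then show "\<mu> \<in> {\<mu>. \<exists>y. R \<mu> y}" by blast
    qed
  qed
  then have "\<forall>\<mu>. \<exists>y. R \<mu> y" by simp
  then obtain L where L: "\<And>\<mu>. R \<mu> (L \<mu>)" by metis
  have R_unique: "y = z" if "R \<mu> y" "R \<mu> z" for \<mu> y z
    by (rule eq_if_functionals_agree) (use that in \<open>simp add: R_def\<close>)
  have add: "L (\<mu> + \<nu>) = L \<mu> + L \<nu>" for \<mu> \<nu> using R_unique[OF L R_add[OF L L]] .
  have scale: "L (r *\<^sub>R \<mu>) = r *\<^sub>R L \<mu>" for r \<mu> using R_unique[OF L R_scale[OF L]] .
  obtain F where F: "norm F \<le> norm f" "\<And>\<mu>. blinfun_apply F \<mu> = L \<mu>"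
    using blinfun_of_bounded_map[OF add scale R_bound[OF L]] by auto
  show ?thesis by (rule that[of F]) (use F L in \<open>auto simp: R_def\<close>)
qed

lemma
  fixes f :: "('a::real_normed_vector, 'b::banach) lip0"
  shows lipfree_linearization_delta: "lipfree_linearization f (lipfree_delta x) = lip0_apply f x"
    and norm_lipfree_linearization_le: "norm (lipfree_linearization f) \<le> norm f"
    and functional_lipfree_linearization:
      "blinfun_apply \<phi> (lipfree_linearization f \<mu>) = lipfree_functional \<mu> (lip0_comp (lip0_of_blinfun \<phi>) f)"
proof -
  obtain L :: "'a lipfree \<Rightarrow>\<^sub>L 'b" where L: "norm L \<le> norm f"
    "\<And>\<mu> \<phi>. blinfun_apply \<phi> (blinfun_apply L \<mu>) = lipfree_functional \<mu> (lip0_comp (lip0_of_blinfun \<phi>) f)"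
    using lipfree_linearization_exists[of f] by metis
  have delta: "L (lipfree_delta x) = lip0_apply f x" for x
    by (rule eq_if_functionals_agree)
      (simp add: L lipfree_delta.rep_eq point_eval.rep_eq lip0_comp.rep_eq lip0_of_blinfun.rep_eq)
  have "lipfree_linearization f = L"
    unfolding lipfree_linearization_def
  proof (rule the_equality)
    fix L' assume "\<forall>x. blinfun_apply L' (lipfree_delta x) = lip0_apply f x"
    then show "L' = L" by (intro lipfree_blinfun_eqI) (simp add: delta)
  qed (simp add: delta)
  then show "lipfree_linearization f (lipfree_delta x) = lip0_apply f x"
    "norm (lipfree_linearization f) \<le> norm f"
    "blinfun_apply \<phi> (lipfree_linearization f \<mu>) = lipfree_functional \<mu> (lip0_comp (lip0_of_blinfun \<phi>) f)"
    using L delta by simp_all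
qed

lemma lipfree_beta_eq_linearization:
  "(lipfree_beta :: 'a::banach lipfree \<Rightarrow>\<^sub>L 'a) = lipfree_linearization (lip0_of_blinfun id_blinfun)"
proof -
  have id: "lip0_comp (lip0_of_blinfun \<phi>) (lip0_of_blinfun id_blinfun) = lip0_of_blinfun \<phi>"
    for \<phi> :: "'a \<Rightarrow>\<^sub>L real"
    by (rule lip0_eqI) (simp add: lip0_comp.rep_eq lip0_of_blinfun.rep_eq)
  show ?thesis
    unfolding lipfree_beta_def
  proof (rule the_equality)
    fix \<beta> :: "'a lipfree \<Rightarrow>\<^sub>L 'a"
    assume \<beta>: "\<forall>\<mu> (\<phi> :: 'a \<Rightarrow>\<^sub>L real). blinfun_apply \<phi> (\<beta> \<mu>) = lipfree_functional \<mu> (lip0_of_blinfun \<phi>)"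
    show "\<beta> = lipfree_linearization (lip0_of_blinfun id_blinfun)"
      by (rule blinfun_eqI, rule eq_if_functionals_agree)
        (simp add: \<beta> functional_lipfree_linearization id)
  qed (simp add: functional_lipfree_linearization id)
qed

lemma lipfree_beta_delta: "lipfree_beta (lipfree_delta x) = (x :: 'a::banach)"
  by (simp add: lipfree_beta_eq_linearization lipfree_linearization_delta lip0_of_blinfun.rep_eq)

text \<open>
  Composition with \<open>f\<close> acts on Lipschitz functions; its adjoint sends deltas to deltas, so by
  continuity it sends the closed span of the deltas into that of the target.
\<close>

lemma lipfree_map_exists:
  fixes f :: "('a::real_normed_vector, 'b::real_normed_vector) lip0"
  obtains F :: "'a lipfree \<Rightarrow>\<^sub>L 'b lipfree" where "norm F \<le> norm f"
    "\<And>x. F (lipfree_delta x) = lipfree_delta (lip0_apply f x)"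
proof -
  define C where "C = Blinfun (\<lambda>g :: ('b, real) lip0. lip0_comp g f)"
  have bl: "bounded_linear (\<lambda>g :: ('b, real) lip0. lip0_comp g f)"
    by (rule bounded_linear_intro[where K = "norm f"])
      (auto intro: lip0_eqI norm_lip0_comp_le simp: lip0_comp.rep_eq lip0_apply_linear)
  have C: "C g = lip0_comp g f" for g by (simp add: C_def bounded_linear_Blinfun_apply[OF bl])
  have norm_C: "norm C \<le> norm f"
    by (rule norm_blinfun_bound) (use norm_lip0_comp_le[of _ f] in \<open>auto simp: C mult.commute\<close>)
  define W :: "(('b, real) lip0 \<Rightarrow>\<^sub>L real) set" where "W = closure (span (range point_eval))"
  define k where "k \<mu> = lipfree_functional \<mu> o\<^sub>L C" for \<mu>
  have k: "bounded_linear k"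
    unfolding k_def
    by (rule bounded_linear_compose[OF
          bounded_bilinear.bounded_linear_left[OF bounded_bilinear_blinfun_compose]
          bounded_linear_lipfree_functional])
  have k_delta: "k (lipfree_delta x) = point_eval (lip0_apply f x)" for x
    by (rule blinfun_eqI) (simp add: k_def C lipfree_delta.rep_eq point_eval.rep_eq lip0_comp.rep_eq)
  have "\<mu> \<in> k -` W" for \<mu>
  proof (rule lipfree_closed_subspace_induct)
    show "subspace (k -` W)"
      unfolding W_def
      by (rule linear_subspace_vimage[OF bounded_linear.linear[OF k] subspace_closure_span])
    show "closed (k -` W)"
      unfolding W_def using linear_continuous_on[OF k] by (intro closed_vimage) auto
    show "lipfree_delta x \<in> k -` W" for x
      unfolding W_def by (auto simp: k_delta intro!: subsetD[OF closure_subset] span_base)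
  qed
  then have rep: "lipfree_functional (Lipfree (k \<mu>)) = k \<mu>" for \<mu>
    by (intro Lipfree_inverse) (auto simp: W_def)
  have eqI: "\<mu> = \<nu>" if "lipfree_functional \<mu> = lipfree_functional \<nu>" for \<mu> \<nu> :: "'b lipfree"
    using that by (simp add: lipfree_functional_inject)
  have bound: "norm (Lipfree (k \<mu>)) \<le> norm f * norm \<mu>" for \<mu>
  proof -
    have "norm (k \<mu>) \<le> norm (lipfree_functional \<mu>) * norm C" unfolding k_def by (rule norm_blinfun_compose)
    also have "\<dots> \<le> norm \<mu> * norm f"
      unfolding norm_lipfree.rep_eq by (intro mult_left_mono norm_C) simp
    finally show ?thesis by (simp add: norm_lipfree.rep_eq rep mult.commute)
  qed
  have add: "Lipfree (k (\<mu> + \<nu>)) = Lipfree (k \<mu>) + Lipfree (k \<nu>)" for \<mu> \<nu>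
    by (rule eqI) (unfold lipfree_functional_linear rep, rule linear_add[OF bounded_linear.linear[OF k]])
  have scale: "Lipfree (k (r *\<^sub>R \<mu>)) = r *\<^sub>R Lipfree (k \<mu>)" for r \<mu>
    by (rule eqI) (unfold lipfree_functional_linear rep, rule linear_scale[OF bounded_linear.linear[OF k]])
  obtain F where F: "norm F \<le> norm f" "\<And>\<mu>. blinfun_apply F \<mu> = Lipfree (k \<mu>)"
    using blinfun_of_bounded_map[OF add scale bound] by auto
  have "F (lipfree_delta x) = lipfree_delta (lip0_apply f x)" for x
    unfolding F(2) by (rule eqI) (unfold rep lipfree_delta.rep_eq, rule k_delta)
  with F(1) show ?thesis by (rule that)
qed

text \<open>
  The elements \<open>\<mu>\<close> at which the approximation can be enforced form a closed subspace, because the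
  linearizations are uniformly bounded, and it contains the deltas.
\<close>

lemma lipfree_linearization_approximates_beta:
  fixes \<mu> :: "'a::banach lipfree"
  assumes "0 < e"
  shows "\<exists>K d. finite K \<and> 0 < d \<and> (\<forall>f :: ('a, 'a) lip0. norm f \<le> c \<longrightarrow>
    (\<forall>x\<in>K. norm (lip0_apply f x - x) < d) \<longrightarrow> norm (lipfree_linearization f \<mu> - lipfree_beta \<mu>) < e)"
proof -
  define D where "D f = lipfree_linearization f - lipfree_beta" for f :: "('a, 'a) lip0"
  define good where "good \<mu> e \<longleftrightarrow> (\<exists>K d. finite K \<and> 0 < d \<and> (\<forall>f. norm f \<le> c \<longrightarrow>
    (\<forall>x\<in>K. norm (lip0_apply f x - x) < d) \<longrightarrow> norm (D f \<mu>) < e))" for \<mu> e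
  have "\<mu> \<in> {\<mu>. \<forall>e>0. good \<mu> e}"
  proof (rule lipfree_closed_subspace_induct)
    show "lipfree_delta x \<in> {\<mu>. \<forall>e>0. good \<mu> e}" for x
    proof (intro CollectI allI impI)
      fix e :: real assume "0 < e"
      then show "good (lipfree_delta x) e"
        unfolding good_def
        by (intro exI[of _ "{x}"] exI[of _ e])
          (simp add: D_def blinfun.diff_left lipfree_linearization_delta lipfree_beta_delta)
    qed
    show "subspace {\<mu>. \<forall>e>0. good \<mu> e}"
    proof (rule subspaceI)
      show "0 \<in> {\<mu>. \<forall>e>0. good \<mu> e}"
        by (auto simp: good_def blinfun.zero_right intro!: exI[of _ "{}"] exI[of _ 1])
    next
      fix \<mu> \<nu> assume mn: "\<mu> \<in> {\<mu>. \<forall>e>0. good \<mu> e}" "\<nu> \<in> {\<mu>. \<forall>e>0. good \<mu> e}"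
      have "good (\<mu> + \<nu>) e" if "0 < e" for e
      proof -
        have "good \<mu> (e / 2)" "good \<nu> (e / 2)" using mn that by auto
        then obtain K d K' d' where
          K: "finite K" "0 < d" "\<And>f. norm f \<le> c \<Longrightarrow> \<forall>x\<in>K. norm (lip0_apply f x - x) < d \<Longrightarrow> norm (D f \<mu>) < e / 2" and
          K': "finite K'" "0 < d'" "\<And>f. norm f \<le> c \<Longrightarrow> \<forall>x\<in>K'. norm (lip0_apply f x - x) < d' \<Longrightarrow> norm (D f \<nu>) < e / 2"
          unfolding good_def by metis
        have "norm (D f (\<mu> + \<nu>)) < e"
          if "norm f \<le> c" "\<forall>x\<in>K \<union> K'. norm (lip0_apply f x - x) < min d d'" for f
        proof -
          have "norm (D f \<mu>) < e / 2" "norm (D f \<nu>) < e / 2" using K(3) K'(3) that by auto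
          then show ?thesis
            using norm_triangle_ineq[of "D f \<mu>" "D f \<nu>"] by (simp add: blinfun.add_right)
        qed
        then show ?thesis
          unfolding good_def using K(1,2) K'(1,2)
          by (intro exI[of _ "K \<union> K'"] exI[of _ "min d d'"]) auto
      qed
      then show "\<mu> + \<nu> \<in> {\<mu>. \<forall>e>0. good \<mu> e}" by blast
    next
      fix r \<mu> assume m: "\<mu> \<in> {\<mu>. \<forall>e>0. good \<mu> e}"
      have "good (r *\<^sub>R \<mu>) e" if "0 < e" for e
      proof -
        have pos: "0 < \<bar>r\<bar> + 1" by simp
        have "good \<mu> (e / (\<bar>r\<bar> + 1))" using m that pos by auto
        then obtain K d where
          K: "finite K" "0 < d" "\<And>f. norm f \<le> c \<Longrightarrow> \<forall>x\<in>K. norm (lip0_apply f x - x) < d \<Longrightarrow> norm (D f \<mu>) < e / (\<bar>r\<bar> + 1)"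
          unfolding good_def by metis
        have "norm (D f (r *\<^sub>R \<mu>)) < e"
          if "norm f \<le> c" "\<forall>x\<in>K. norm (lip0_apply f x - x) < d" for f
        proof -
          have "norm (D f (r *\<^sub>R \<mu>)) \<le> (\<bar>r\<bar> + 1) * norm (D f \<mu>)"
            by (simp add: blinfun.scaleR_right distrib_right)
          also have "\<dots> < e" using K(3)[OF that] pos by (simp add: field_simps)
          finally show ?thesis .
        qed
        then show ?thesis unfolding good_def using K(1,2) by blast
      qed
      then show "r *\<^sub>R \<mu> \<in> {\<mu>. \<forall>e>0. good \<mu> e}" by blast
    qed
    show "closed {\<mu>. \<forall>e>0. good \<mu> e}"
    proof (rule closure_subset_eq[THEN iffD1], rule subsetI, rule CollectI, intro allI impI)
      fix \<mu> and e :: real assume m: "\<mu> \<in> closure {\<mu>. \<forall>e>0. good \<mu> e}" and e: "0 < e"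
      \<comment> \<open>A common positive bound for the operators \<open>D f\<close>.\<close>
      define B where "B = \<bar>c\<bar> + norm (lipfree_beta :: 'a lipfree \<Rightarrow>\<^sub>L 'a) + 1"
      have B: "0 < B" by (simp add: B_def add_nonneg_pos)
      have DB: "norm (D f) \<le> B" if "norm f \<le> c" for f
        using norm_triangle_ineq4[of "lipfree_linearization f" lipfree_beta]
          norm_lipfree_linearization_le[of f] that by (simp add: D_def B_def)
      have "0 < e / (2 * B)" using e B by simp
      then obtain \<nu> where \<nu>: "\<forall>e>0. good \<nu> e" "norm (\<mu> - \<nu>) < e / (2 * B)"
        using m by (auto simp: closure_approachable dist_norm norm_minus_commute)
      have "0 < e / 2" using e by simp
      with \<nu>(1) have "good \<nu> (e / 2)" by blast
      then obtain K d where
        K: "finite K" "0 < d" "\<And>f. norm f \<le> c \<Longrightarrow> \<forall>x\<in>K. norm (lip0_apply f x - x) < d \<Longrightarrow> norm (D f \<nu>) < e / 2"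
        unfolding good_def by metis
      have "norm (D f \<mu>) < e"
        if f: "norm f \<le> c" "\<forall>x\<in>K. norm (lip0_apply f x - x) < d" for f
      proof -
        have "norm (D f (\<mu> - \<nu>)) \<le> norm (D f) * norm (\<mu> - \<nu>)" by (rule norm_blinfun)
        also have "\<dots> \<le> B * norm (\<mu> - \<nu>)" by (intro mult_right_mono DB f(1)) simp
        also have "\<dots> \<le> e / 2" using \<nu>(2) B by (simp add: field_simps)
        finally have "norm (D f (\<mu> - \<nu>)) \<le> e / 2" .
        moreover have "norm (D f \<nu>) < e / 2" by (rule K(3)[OF f])
        moreover have "D f \<mu> = D f (\<mu> - \<nu>) + D f \<nu>" by (simp add: blinfun.diff_right)
        ultimately show ?thesis using norm_triangle_ineq[of "D f (\<mu> - \<nu>)" "D f \<nu>"] by simp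
      qed
      then show "good \<mu> e" unfolding good_def using K(1,2) by blast
    qed
  qed
  then have "good \<mu> e" using \<open>0 < e\<close> by simp
  then show ?thesis by (simp add: good_def D_def blinfun.diff_left)
qed

section \<open>Transfer from Lipschitz to linear approximation\<close>

text \<open>
  Finite sets are compact, so the compact-open closure supplies a map close to the identity at all the
  finitely many points on which the values at \<open>F\<close> depend.
\<close>

lemma Lip_K_BAP_approximates_beta:
  assumes "Lip_K_BAP TYPE('x::banach)"
  obtains c where "1 \<le> c" "\<And>F e. finite F \<Longrightarrow> 0 < e \<Longrightarrow>
    \<exists>f\<in>lip_compact_maps c. \<forall>\<mu>\<in>F. norm (lipfree_linearization f \<mu> - lipfree_beta (\<mu> :: 'x lipfree)) < e"
proof -
  obtain c where c: "1 \<le> c"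
    "(id :: 'x \<Rightarrow> 'x) \<in> compact_open_topology closure_of (lip0_apply ` lip_compact_maps c)"
    using assms unfolding Lip_K_BAP_def by blast
  have "\<exists>f\<in>lip_compact_maps c. \<forall>\<mu>\<in>F. norm (lipfree_linearization f \<mu> - lipfree_beta (\<mu> :: 'x lipfree)) < e"
    if "finite F" "0 < e" for F e
  proof -
    have "\<exists>K d. finite K \<and> 0 < d \<and> (\<forall>f :: ('x, 'x) lip0. norm f \<le> c \<longrightarrow>
      (\<forall>x\<in>K. norm (lip0_apply f x - x) < d) \<longrightarrow>
      (\<forall>\<mu>\<in>F. norm (lipfree_linearization f \<mu> - lipfree_beta \<mu>) < e))"
      using \<open>finite F\<close>
    proof induction
      case empty
      show ?case by (intro exI[of _ "{}"] exI[of _ 1]) simp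
    next
      case (insert \<mu> F)
      then obtain K d where K: "finite K" "0 < d" "\<And>f :: ('x, 'x) lip0. norm f \<le> c \<Longrightarrow>
          \<forall>x\<in>K. norm (lip0_apply f x - x) < d \<Longrightarrow>
          \<forall>\<mu>\<in>F. norm (lipfree_linearization f \<mu> - lipfree_beta \<mu>) < e" by metis
      obtain K' d' where K': "finite K'" "0 < d'" "\<And>f :: ('x, 'x) lip0. norm f \<le> c \<Longrightarrow>
          \<forall>x\<in>K'. norm (lip0_apply f x - x) < d' \<Longrightarrow>
          norm (lipfree_linearization f \<mu> - lipfree_beta \<mu>) < e"
        using lipfree_linearization_approximates_beta[OF \<open>0 < e\<close>, of c \<mu>] by metis
      show ?case
        using K K' by (intro exI[of _ "K \<union> K'"] exI[of _ "min d d'"]) auto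
    qed
    then obtain K d where K: "finite K" "0 < d" "\<And>f :: ('x, 'x) lip0. norm f \<le> c \<Longrightarrow>
        \<forall>x\<in>K. norm (lip0_apply f x - x) < d \<Longrightarrow>
        \<forall>\<mu>\<in>F. norm (lipfree_linearization f \<mu> - lipfree_beta \<mu>) < e" by metis
    obtain f where f: "f \<in> lip_compact_maps c" "\<forall>x\<in>K. dist (lip0_apply f x) (id x) < d"
      using c(2) finite_imp_compact[OF K(1)] K(2) unfolding in_closure_of_compact_open_topology by blast
    then have "\<forall>\<mu>\<in>F. norm (lipfree_linearization f \<mu> - lipfree_beta \<mu>) < e"
      by (intro K(3)) (auto simp: lip_compact_maps_def dist_norm)
    with f(1) show ?thesis by blast
  qed
  with c(1) show ?thesis by (rule that)
qed

text \<open>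
  Here \<open>E\<close> is the map of free spaces induced by \<open>J\<close>.  Naturality of \<open>\<beta>\<close> gives \<open>\<beta> E U = J \<beta> U = J\<close>, and
  \<open>E U\<close> has norm at most 1, so composition with it preserves compactness and the constant.
\<close>

lemma lifting_compact_approximation:
  fixes J :: "'m::banach \<Rightarrow> 'x::banach"
  assumes J: "linear J" "\<And>y. norm (J y) = norm y"
    and "isometric_lifting_property TYPE('m)" and "Lip_K_BAP TYPE('x)"
  obtains c where "1 \<le> c" "\<And>F e. finite F \<Longrightarrow> 0 < e \<Longrightarrow>
    \<exists>S \<in> compact_operators c. \<forall>y\<in>F. norm (blinfun_apply S y - J y) < e"
proof -
  have J_bl: "bounded_linear J"
    by (rule bounded_linear_intro[where K = 1]) (simp_all add: J linear_add linear_scale)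
  define J' where "J' = Blinfun J"
  have J': "J' y = J y" for y by (simp add: J'_def bounded_linear_Blinfun_apply[OF J_bl])
  have "norm (lip0_of_blinfun J') \<le> 1"
    by (rule norm_lip0_le) (simp_all add: lip0_of_blinfun.rep_eq J' J flip: linear_diff[OF J(1)])
  then obtain E :: "'m lipfree \<Rightarrow>\<^sub>L 'x lipfree" where E: "norm E \<le> 1" "\<And>y. E (lipfree_delta y) = lipfree_delta (J y)"
    using lipfree_map_exists[of "lip0_of_blinfun J'"] unfolding lip0_of_blinfun.rep_eq J'
    by (metis order_trans)
  obtain U :: "'m \<Rightarrow>\<^sub>L 'm lipfree" where U: "norm U = 1" "lipfree_beta o\<^sub>L U = id_blinfun"
    using assms(3) unfolding isometric_lifting_property_def by blast
  have "lipfree_beta o\<^sub>L E = J' o\<^sub>L lipfree_beta"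
    by (rule lipfree_blinfun_eqI) (simp add: E lipfree_beta_delta J')
  then have beta: "lipfree_beta (E (U y)) = J y" for y
    using blinfun_apply_blinfun_compose[of lipfree_beta E "U y"] blinfun_apply_blinfun_compose[of lipfree_beta U y]
    by (simp add: U J')
  have "norm (E o\<^sub>L U) \<le> norm E * norm U" by (rule norm_blinfun_compose)
  also have "\<dots> \<le> 1" using E(1) U(1) by simp
  finally have EU: "norm (E o\<^sub>L U) \<le> 1" .
  obtain c where c: "1 \<le> c" "\<And>F e. finite F \<Longrightarrow> 0 < e \<Longrightarrow>
    \<exists>f\<in>lip_compact_maps c. \<forall>\<mu>\<in>F. norm (lipfree_linearization f \<mu> - lipfree_beta (\<mu> :: 'x lipfree)) < e"
    using Lip_K_BAP_approximates_beta[OF assms(4)] by blast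
  have "\<exists>S \<in> compact_operators c. \<forall>y\<in>F. norm (blinfun_apply S y - J y) < e" if "finite F" "0 < e" for F e
  proof -
    obtain f where f: "f \<in> lip_compact_maps c"
      "\<forall>\<mu>\<in>(\<lambda>y. E (U y)) ` F. norm (lipfree_linearization f \<mu> - lipfree_beta (\<mu> :: 'x lipfree)) < e"
      using c(2)[OF finite_imageI[OF \<open>finite F\<close>] \<open>0 < e\<close>] by blast
    define S where "S = lipfree_linearization f o\<^sub>L (E o\<^sub>L U)"
    have "norm S \<le> norm (lipfree_linearization f) * norm (E o\<^sub>L U)" unfolding S_def by (rule norm_blinfun_compose)
    also have "\<dots> \<le> norm (lipfree_linearization f) * 1" by (intro mult_left_mono EU norm_ge_zero)
    also have "\<dots> \<le> c" using norm_lipfree_linearization_le[of f] f(1) by (simp add: lip_compact_maps_def)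
    finally have "norm S \<le> c" .
    moreover have "compact_operator S"
      unfolding S_def using f(1) EU by (intro compact_operator_compose_right) (simp_all add: lip_compact_maps_def)
    moreover have "\<forall>y\<in>F. norm (S y - J y) < e" using f(2) by (simp add: S_def beta)
    ultimately show ?thesis by (auto simp: compact_operators_def)
  qed
  with c(1) show ?thesis by (rule that)
qed

text \<open>
  Extensions to \<open>X\<close> of a functional on \<open>M\<close> differ by elements of the annihilator, which is the kernel of
  \<open>P\<close>; so the value of \<open>P\<close> at an extension does not depend on the choice and is linear in the functional.
  It is again an extension, because \<open>P \<psi> - \<psi>\<close> lies in the kernel of the projection.
\<close>

lemma ideal_extension_operator:
  fixes M :: "'x::banach set" and J :: "'m::banach \<Rightarrow> 'x"
  assumes J: "linear J" "\<And>y. norm (J y) = norm y" and "range J = M" and "is_ideal_in_space M"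
  obtains \<sigma> :: "('m \<Rightarrow>\<^sub>L real) \<Rightarrow>\<^sub>L ('x \<Rightarrow>\<^sub>L real)" where "norm \<sigma> \<le> 1"
    "\<And>\<phi> y. blinfun_apply (\<sigma> \<phi>) (J y) = \<phi> y"
proof -
  obtain P :: "('x \<Rightarrow>\<^sub>L real) \<Rightarrow>\<^sub>L ('x \<Rightarrow>\<^sub>L real)" where
    P: "P o\<^sub>L P = P" "norm P = 1" "{\<phi>. blinfun_apply P \<phi> = 0} = annihilator M"
    using assms(4) unfolding is_ideal_in_space_def by blast
  have ker: "P \<psi> = 0 \<longleftrightarrow> (\<forall>y. blinfun_apply \<psi> (J y) = 0)" for \<psi>
    using P(3) unfolding annihilator_def assms(3)[symmetric] by auto
  have P_J: "P \<psi> (J y) = blinfun_apply \<psi> (J y)" for \<psi> y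
  proof -
    have "P (P \<psi> - \<psi>) = (P o\<^sub>L P) \<psi> - P \<psi>" by (simp add: blinfun.diff_right)
    then have "P (P \<psi> - \<psi>) = 0" by (simp add: P(1))
    then show ?thesis by (simp add: ker blinfun.diff_left)
  qed
  have P_cong: "P \<psi> = P \<psi>'" if "\<And>y. blinfun_apply \<psi> (J y) = blinfun_apply \<psi>' (J y)" for \<psi> \<psi>'
    using ker[of "\<psi> - \<psi>'"] that by (simp add: blinfun.diff_left blinfun.diff_right)
  have "\<exists>\<psi> :: 'x \<Rightarrow>\<^sub>L real. norm \<psi> \<le> norm \<phi> \<and> (\<forall>y. blinfun_apply \<psi> (J y) = \<phi> y)" for \<phi> :: "'m \<Rightarrow>\<^sub>L real"
    using hahn_banach_extension[OF J, of \<phi>] by metis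
  then obtain ext :: "('m \<Rightarrow>\<^sub>L real) \<Rightarrow> ('x \<Rightarrow>\<^sub>L real)" where
    ext: "\<And>\<phi>. norm (ext \<phi>) \<le> norm \<phi>" "\<And>\<phi> y. blinfun_apply (ext \<phi>) (J y) = blinfun_apply \<phi> y" by metis
  have bound: "norm (P (ext \<phi>)) \<le> 1 * norm \<phi>" for \<phi>
    using norm_blinfun[of P "ext \<phi>"] ext(1)[of \<phi>] by (simp add: P(2))
  have add: "P (ext (\<phi> + \<phi>')) = P (ext \<phi>) + P (ext \<phi>')" for \<phi> \<phi>'
    unfolding blinfun.add_right[symmetric] by (rule P_cong) (simp add: ext blinfun.add_left)
  have scale: "P (ext (r *\<^sub>R \<phi>)) = r *\<^sub>R P (ext \<phi>)" for r \<phi>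
    unfolding blinfun.scaleR_right[symmetric] by (rule P_cong) (simp add: ext blinfun.scaleR_left)
  obtain \<sigma> where \<sigma>: "norm \<sigma> \<le> 1" "\<And>\<phi>. blinfun_apply \<sigma> \<phi> = P (ext \<phi>)"
    using blinfun_of_bounded_map[OF add scale bound] by auto
  then have "\<sigma> \<phi> (J y) = \<phi> y" for \<phi> y by (simp add: P_J ext)
  with \<sigma>(1) show ?thesis by (rule that)
qed

text \<open>
  The operators are \<open>S\<^sup>* \<sigma>\<close>, where \<open>S\<close> approximates \<open>J\<close> and \<open>\<sigma>\<close> is the extension operator of the ideal:
  \<open>(S\<^sup>* \<sigma> \<phi>) y - \<phi> y = \<sigma> \<phi> (S y - J y)\<close>.
\<close>

lemma dual_identity_approximation:
  fixes M :: "'x::banach set" and J :: "'m::banach \<Rightarrow> 'x"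
  assumes J: "linear J" "\<And>y. norm (J y) = norm y" "range J = M"
    and "is_ideal_in_space M" "isometric_lifting_property TYPE('m)" "Lip_K_BAP TYPE('x)"
  obtains c where "1 \<le> c" "\<And>F e. finite F \<Longrightarrow> 0 < e \<Longrightarrow>
    \<exists>R :: ('m \<Rightarrow>\<^sub>L real) \<Rightarrow>\<^sub>L ('m \<Rightarrow>\<^sub>L real). R \<in> compact_operators c \<and>
      (\<forall>(\<phi>, y)\<in>F. \<bar>blinfun_apply (blinfun_apply R \<phi>) y - blinfun_apply \<phi> y\<bar> < e)"
proof -
  obtain \<sigma> :: "('m \<Rightarrow>\<^sub>L real) \<Rightarrow>\<^sub>L ('x \<Rightarrow>\<^sub>L real)" where
    \<sigma>: "norm \<sigma> \<le> 1" "\<And>\<phi> y. blinfun_apply (\<sigma> \<phi>) (J y) = \<phi> y"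
    using ideal_extension_operator[OF J assms(4)] by metis
  obtain c where c: "1 \<le> c" "\<And>F e. finite F \<Longrightarrow> 0 < e \<Longrightarrow>
    \<exists>S \<in> compact_operators c. \<forall>y\<in>F. norm (blinfun_apply S y - J y) < e"
    using lifting_compact_approximation[OF J(1,2) assms(5,6)] by blast
  have "\<exists>R :: ('m \<Rightarrow>\<^sub>L real) \<Rightarrow>\<^sub>L ('m \<Rightarrow>\<^sub>L real). R \<in> compact_operators c \<and>
      (\<forall>(\<phi>, y)\<in>F. \<bar>blinfun_apply (blinfun_apply R \<phi>) y - blinfun_apply \<phi> y\<bar> < e)" if F: "finite F" and e: "0 < e" for F e
  proof -
    \<comment> \<open>A positive bound for the finitely many functionals that occur in \<open>F\<close>.\<close>
    define B where "B = 1 + (\<Sum>p\<in>F. norm (fst p))"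
    have "0 < B" unfolding B_def by (intro add_pos_nonneg sum_nonneg) auto
    have B: "norm \<phi> \<le> B" if "(\<phi>, y) \<in> F" for \<phi> y
      using member_le_sum[OF that, of "\<lambda>p. norm (fst p)"] F by (simp add: B_def)
    obtain S where S: "S \<in> compact_operators c" "\<forall>y\<in>snd ` F. norm (blinfun_apply S y - J y) < e / B"
      using c(2)[of "snd ` F" "e / B"] F e \<open>0 < B\<close> by auto
    obtain A where A: "adjoint_pair S A" "norm A \<le> norm S" by (rule adjoint_exists)
    define R where "R = A o\<^sub>L \<sigma>"
    have "compact_operator A" using S(1) schauder[OF A(1)] by (simp add: compact_operators_def)
    then have "compact_operator R" unfolding R_def by (rule compact_operator_compose_right) (rule \<sigma>(1))
    moreover have "norm R \<le> c"
    proof -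
      have "norm R \<le> norm A * norm \<sigma>" unfolding R_def by (rule norm_blinfun_compose)
      also have "\<dots> \<le> norm A * 1" by (intro mult_left_mono \<sigma>(1) norm_ge_zero)
      finally show ?thesis using A(2) S(1) by (simp add: compact_operators_def)
    qed
    moreover have "\<bar>R \<phi> y - \<phi> y\<bar> < e" if "(\<phi>, y) \<in> F" for \<phi> y
    proof -
      have y: "norm (S y - J y) < e / B" using S(2) that by force
      have "R \<phi> y - \<phi> y = \<sigma> \<phi> (S y - J y)"
        using A(1) by (simp add: R_def adjoint_pair_def blinfun.diff_right \<sigma>(2))
      then have "\<bar>R \<phi> y - \<phi> y\<bar> \<le> norm (\<sigma> \<phi>) * norm (S y - J y)"
        using norm_blinfun[of "\<sigma> \<phi>" "S y - J y"] by simp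
      also have "norm (\<sigma> \<phi>) \<le> B"
      proof -
        have "norm (\<sigma> \<phi>) \<le> norm \<sigma> * norm \<phi>" by (rule norm_blinfun)
        also have "\<dots> \<le> 1 * norm \<phi>" by (intro mult_right_mono \<sigma>(1)) simp
        finally show ?thesis using B[OF that] by simp
      qed
      then have "norm (\<sigma> \<phi>) * norm (S y - J y) \<le> B * norm (S y - J y)" by (intro mult_right_mono) auto
      also have "\<dots> < e" using y \<open>0 < B\<close> by (simp add: field_simps)
      finally show ?thesis .
    qed
    ultimately show ?thesis by (intro exI[of _ R]) (auto simp: compact_operators_def)
  qed
  with c(1) show ?thesis by (rule that)
qed

theorem proposition4p5:
  fixes M :: "'x::banach set" and J :: "'m::banach \<Rightarrow> 'x"
  assumes "subspace M" and "closed M"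
    and "linear J" and "\<And>y. norm (J y) = norm y" and "range J = M"
    and "is_ideal_in_space M"
    and "isometric_lifting_property TYPE('m)"
    and "Lip_K_BAP TYPE('x)"
    and "dual_has_BWstarD TYPE('m)"
  shows "K_BAP TYPE('m)"
proof -
  obtain c where c: "1 \<le> c" "\<And>F e. finite F \<Longrightarrow> 0 < e \<Longrightarrow>
    \<exists>R :: ('m \<Rightarrow>\<^sub>L real) \<Rightarrow>\<^sub>L ('m \<Rightarrow>\<^sub>L real). R \<in> compact_operators c \<and>
      (\<forall>(\<phi>, y)\<in>F. \<bar>blinfun_apply (blinfun_apply R \<phi>) y - blinfun_apply \<phi> y\<bar> < e)"
    using dual_identity_approximation[OF assms(3-8)] by blast
  obtain k where k: "1 \<le> k" "(compact_operators 1 :: (('m \<Rightarrow>\<^sub>L real) \<Rightarrow>\<^sub>L ('m \<Rightarrow>\<^sub>L real)) set)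
            \<subseteq> dual_operator_weak_star_topology closure_of weak_star_compact_operators k"
    using assms(9) unfolding dual_has_BWstarD_def by blast
  have weak: "\<exists>T\<in>compact_operators (c * k). \<forall>(\<phi> :: 'm \<Rightarrow>\<^sub>L real, z)\<in>F.
      \<bar>blinfun_apply \<phi> (blinfun_apply T z) - \<phi> (blinfun_apply id_blinfun z)\<bar> < e"
    if F: "finite F" and e: "0 < e" for F e
  proof -
    obtain R :: "('m \<Rightarrow>\<^sub>L real) \<Rightarrow>\<^sub>L ('m \<Rightarrow>\<^sub>L real)" where
      R: "R \<in> compact_operators c" "\<forall>(\<phi>, y)\<in>F. \<bar>blinfun_apply (blinfun_apply R \<phi>) y - blinfun_apply \<phi> y\<bar> < e / 2"
      using c(2)[OF F, of "e / 2"] e by auto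
    \<comment> \<open>The density hypothesis concerns operators of norm at most 1.\<close>
    have "(1 / c) *\<^sub>R R \<in> compact_operators (1 / c * c)"
      using R(1) c(1) by (intro compact_operators_scaleR) auto
    then have "(1 / c) *\<^sub>R R \<in> compact_operators 1" using c(1) by simp
    then have cl: "(1 / c) *\<^sub>R R \<in> dual_operator_weak_star_topology closure_of weak_star_compact_operators k"
      using k(2) by blast
    have "0 < e / (2 * c)" using e c(1) by simp
    then obtain S where S: "S \<in> weak_star_compact_operators k"
      "\<forall>(\<phi>, z)\<in>F. \<bar>blinfun_apply (blinfun_apply S \<phi>) z - blinfun_apply (blinfun_apply ((1 / c) *\<^sub>R R) \<phi>) z\<bar> < e / (2 * c)"
      using weak_star_closure_approximates[OF cl F] by blast
    obtain T where T: "adjoint_pair T S" "norm T \<le> norm S"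
      using weak_star_continuous_operator_is_adjoint[of S] S(1)
      unfolding weak_star_compact_operators_def by blast
    have "compact_operator S" "norm S \<le> k" using S(1) by (auto simp: weak_star_compact_operators_def compact_operators_def)
    then have "T \<in> compact_operators k" using schauder[OF T(1)] T(2) by (simp add: compact_operators_def)
    then have "c *\<^sub>R T \<in> compact_operators (c * k)" using c(1) by (intro compact_operators_scaleR) auto
    moreover have "\<bar>\<phi> ((c *\<^sub>R T) z) - \<phi> z\<bar> < e" if p: "(\<phi>, z) \<in> F" for \<phi> z
    proof -
      have "\<bar>S \<phi> z - (1 / c) * R \<phi> z\<bar> < e / (2 * c)" using S(2) p by (auto simp: blinfun.scaleR_left)
      then have "c * \<bar>S \<phi> z - (1 / c) * R \<phi> z\<bar> < e / 2" using c(1) by (simp add: field_simps)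
      moreover have "c * \<bar>S \<phi> z - (1 / c) * R \<phi> z\<bar> = \<bar>c * S \<phi> z - R \<phi> z\<bar>"
        using c(1) by (simp add: abs_mult_pos' right_diff_distrib)
      ultimately have "\<bar>c * S \<phi> z - R \<phi> z\<bar> < e / 2" by simp
      moreover have "\<bar>R \<phi> z - \<phi> z\<bar> < e / 2" using R(2) p by auto
      moreover have "\<phi> ((c *\<^sub>R T) z) - \<phi> z = (c * S \<phi> z - R \<phi> z) + (R \<phi> z - \<phi> z)"
        using T(1) by (simp add: adjoint_pair_def blinfun.scaleR_left blinfun.scaleR_right)
      ultimately show ?thesis
        using abs_triangle_ineq[of "c * S \<phi> z - R \<phi> z" "R \<phi> z - \<phi> z"] by simp
    qed
    ultimately show ?thesis by (intro bexI[of _ "c *\<^sub>R T"]) auto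
  qed
  show ?thesis
  proof (rule K_BAP_if_pointwise_approximation)
    have "1 * 1 \<le> c * k" using c(1) k(1) by (intro mult_mono) auto
    then show "1 \<le> c * k" by simp
    show "\<exists>T\<in>compact_operators (c * k). \<forall>z\<in>F. norm (blinfun_apply T z - (z :: 'm)) < e"
      if "finite F" "0 < e" for F e
      using convex_weak_operator_approximation_imp_strong[OF convex_compact_operators weak that] by simp
  qed
qed

end
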